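(* For every integer $n\ge 0$, the following congruences hold: \begin{align*} c\phi_{3}(3n+1) &\equiv 0 \pmod{3^2}, & c\phi_{3}(3n+2) &\equiv 0 \pmod{3^3},\\ c\phi_{3}(9n+5) &\equiv 0 \pmod{3^5}, & c\phi_{3}(9n+8) &\equiv 0 \pmod{3^7},\\ c\phi_{3}(27n+17) &\equiv 0 \pmod{3^8}, & c\phi_{3}(27n+26) &\equiv 0 \pmod{3^9},\\ c\phi_{3}(81n+44) &\equiv 0 \pmod{3^{10}}, & c\phi_{3}(81n+71) &\equiv 0 \pmod{3^{12}},\\ c\phi_{3}(243n+152) &\equiv 0 \pmod{3^{13}}, & c\phi_{3}(243n+233) &\equiv 0 \pmod{3^{14}}. \end{align*}
   Context: For a positive integer $k$, color each nonnegative integer with each of $k$ colors $1,\dots,k$, writing $a_c$ for $a$ with color $c$, and order colored integers by $0_1\prec 0_2\prec\cdots\prec 0_k\prec 1_1\prec\cdots\prec 1_k\prec 2_1\prec\cdots$. A $k$-colored generalized Frobenius partition of $n$ is a two-row array $\begin{pmatrix} a_1,\dots,a_r\\ b_1,\dots,b_r\end{pmatrix}$ of colored integers with $a_r\prec a_{r-1}\prec\cdots\prec a_1$ and $b_r\prec\cdots\prec b_1$ and $n=r+\sum_{i=1}^r(a_i+b_i)$ (the sum using the underlying integers). $c\phi_k(n)$ denotes the number of $k$-colored generalized Frobenius partitions of $n$. Equivalently, $\sum_{n\ge0}c\phi_k(n)q^n=\frac{1}{(q;q)_\infty^k}\sum_{m_1,\dots,m_{k-1}\in\mathbb{Z}}q^{\sum_i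 m_i^2+\sum_{i<j}m_im_j}$, where $(q;q)_\infty=\prod_{n\ge1}(1-q^n)$. *)

theory Defs
  imports "HOL-Number_Theory.Cong"
begin

text \<open>The colored integer \<open>a\<^sub>c\<close> is the pair \<open>(a, c)\<close>.\<close>

definition colored_nats :: "nat \<Rightarrow> (nat \<times> nat) set" where
  "colored_nats k = UNIV \<times> {1..k}"

definition colored_less :: "nat \<times> nat \<Rightarrow> nat \<times> nat \<Rightarrow> bool" where
  "colored_less x y \<longleftrightarrow> fst x < fst y \<or> (fst x = fst y \<and> snd x < snd y)"

definition is_frobenius_row :: "nat \<Rightarrow> (nat \<times> nat) list \<Rightarrow> bool" where
  "is_frobenius_row k xs \<longleftrightarrow>
     set xs \<subseteq> colored_nats k \<and> sorted_wrt (\<lambda>x y. colored_less y x) xs"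

text \<open>The empty array (\<open>r = 0\<close>) is allowed; it is the unique partition of \<open>0\<close>.\<close>

definition gen_frobenius_partitions ::
  "nat \<Rightarrow> nat \<Rightarrow> ((nat \<times> nat) list \<times> (nat \<times> nat) list) set" where
  "gen_frobenius_partitions k n =
     {(as, bs). is_frobenius_row k as \<and> is_frobenius_row k bs \<and> length as = length bs \<and>
        n = length as + (\<Sum>i<length as. fst (as ! i) + fst (bs ! i))}"

definition cphi :: "nat \<Rightarrow> nat \<Rightarrow> nat" where
  "cphi k n = card (gen_frobenius_partitions k n)"

text \<open>The counted sets are finite, so \<^const>\<open>card\<close> is not the junk value \<open>0\<close>.\<close>

lemma finite_gen_frobenius_partitions: "finite (gen_frobenius_partitions k n)"
proof -
  let ?L = "{xs. set xs \<subseteq> {..n} \<times> {1..k} \<and> length xs \<le> n}"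
  have "gen_frobenius_partitions k n \<subseteq> ?L \<times> ?L"
  proof (rule subsetI)
    fix p assume "p \<in> gen_frobenius_partitions k n"
    then obtain as bs where p: "p = (as, bs)"
      and as: "set as \<subseteq> UNIV \<times> {1..k}" and bs: "set bs \<subseteq> UNIV \<times> {1..k}"
      and len: "length as = length bs"
      and n: "n = length as + (\<Sum>i<length as. fst (as ! i) + fst (bs ! i))"
      unfolding gen_frobenius_partitions_def is_frobenius_row_def colored_nats_def by blast
    have bound: "fst (as ! i) + fst (bs ! i) \<le> n" if "i < length as" for i
    proof -
      have "fst (as ! i) + fst (bs ! i) \<le> (\<Sum>i<length as. fst (as ! i) + fst (bs ! i))"
        using that by (intro member_le_sum) auto
      with n show ?thesis by linarith
    qed
    have "fst x \<le> n" if "x \<in> set as" for x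
    proof -
      from that obtain i where "i < length as" "x = as ! i" by (auto simp: in_set_conv_nth)
      with bound[of i] show ?thesis by simp
    qed
    moreover have "fst x \<le> n" if "x \<in> set bs" for x
    proof -
      from that obtain i where "i < length as" "x = bs ! i"
        using len by (auto simp: in_set_conv_nth)
      with bound[of i] show ?thesis by simp
    qed
    moreover have "length as \<le> n" using n by linarith
    ultimately show "p \<in> ?L \<times> ?L"
      using as bs len p by (fastforce simp: mem_Times_iff)
  qed
  moreover have "finite ?L"
    by (rule finite_lists_length_le) simp
  ultimately show ?thesis
    by (meson finite_SigmaI finite_subset)
qed

end

theory Submission
  imports Defs "HOL-Computational_Algebra.Formal_Laurent_Series"
begin

text \<open>Writing the colored integer \<open>a\<^sub>c\<close> as \<open>3a+c-1\<close>, a 3-colored Frobenius partition becomes a pair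
  of finite sets of naturals of equal size, that is, a Maya diagram of charge 0. Splitting such diagrams
  modulo 3 and shifting away the charges of the three parts gives, for the partition series
  \<open>P(q)\<close> and the cubic theta function \<open>a(q)\<close>, the identities \<open>\<Sum>c\<phi>\<^sub>3(n)q\<^sup>n = a(q)P(q)\<^sup>3\<close> and
  \<open>c(q\<^sup>3) = 3qP(q\<^sup>3)/P(q\<^sup>9)\<^sup>3\<close>, and a cyclic rotation inside an incomplete block of three colors gives
  \<open>b(q) = P(q\<^sup>3)/P(q)\<^sup>3 = a(q\<^sup>3)-c(q\<^sup>3)\<close>. With \<open>a(q) = a(q\<^sup>3)+2c(q\<^sup>3)\<close> these imply
  \<open>a\<^sup>3 = b\<^sup>3+c\<^sup>3\<close>. Consequently \<open>a(q)\<close> and \<open>P(q)\<^sup>3\<close> are, up to series in \<open>q\<^sup>3\<close>, integer forms in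
  \<open>z = a(q\<^sup>3)\<close> and \<open>y = c(q\<^sup>3)\<close>, where \<open>y\<close> is \<open>3q\<close> times a series in \<open>q\<^sup>3\<close> and
  \<open>c(q)\<^sup>3 = 9y(z\<^sup>2+zy+y\<^sup>2)\<close>. Extracting an arithmetic progression modulo 3 maps such forms to such
  forms and gains powers of 3 that are visible in the lowest few coefficients.\<close>

unbundle fps_syntax

section \<open>Trisection of power series and generating functions of weighted sets\<close>

definition cube :: "int fps \<Rightarrow> int fps" where
  "cube f = fps_compose f (fps_X ^ 3)"

definition sect :: "nat \<Rightarrow> int fps \<Rightarrow> int fps" where
  "sect r f = Abs_fps (\<lambda>n. f $ (3 * n + r))"

lemma cube_nth: "cube f $ n = (if 3 dvd n then f $ (n div 3) else 0)"
  by (simp add: cube_def fps_nth_compose_X_power)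

lemma cube_mult: "cube (f * g) = cube f * cube g"
  unfolding cube_def by (rule fps_compose_mult_distrib) simp

lemma cube_power: "cube (f ^ n) = cube f ^ n"
  unfolding cube_def by (rule fps_compose_power [symmetric]) simp

lemma cube_add: "cube (f + g) = cube f + cube g"
  by (simp add: cube_def fps_compose_add_distrib)

lemma cube_diff: "cube (f - g) = cube f - cube g"
  by (simp add: cube_def fps_compose_sub_distrib)

lemma cube_of_int [simp]: "cube (of_int c) = of_int c"
  by (simp add: cube_def fps_of_int [symmetric])

lemma cube_one [simp]: "cube 1 = 1"
  by (simp add: cube_def)

lemma cube_numeral [simp]: "cube (numeral c) = numeral c"
  using cube_of_int[of "numeral c"] by simp

lemma cube_X: "cube fps_X = fps_X ^ 3"
  by (simp add: cube_def)

lemma sect_nth [simp]: "sect r f $ n = f $ (3 * n + r)"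
  by (simp add: sect_def)

lemma sect_sum: "sect r (sum f A) = (\<Sum>x\<in>A. sect r (f x))"
  by (rule fps_ext) (simp add: fps_sum_nth)

lemma sect_of_int_mult: "sect r (of_int c * f) = of_int c * sect r f"
  by (rule fps_ext) (simp add: fps_of_int [symmetric])

text \<open>In the Cauchy product only indices \<open>3 * j\<close> of the first factor contribute,
  and \<open>3 * n + r - 3 * j\<close> has residue \<open>r\<close> again. Hence a series in q^3
  acts as a scalar for extraction, with q^3 replaced by q.\<close>

lemma sect_cube_mult:
  assumes "r < 3"
  shows "sect r (cube g * f) = g * sect r f"
proof (rule fps_ext)
  fix n
  have "sect r (cube g * f) $ n = (\<Sum>i\<in>{0..3*n+r}. cube g $ i * f $ (3*n+r-i))"
    by (simp add: fps_mult_nth)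
  also have "\<dots> = (\<Sum>i\<in>(*) 3 ` {0..n}. cube g $ i * f $ (3*n+r-i))"
  proof (rule sum.mono_neutral_right)
    show "\<forall>i\<in>{0..3*n+r} - (*) 3 ` {0..n}. cube g $ i * f $ (3*n+r-i) = 0"
    proof
      fix i assume i: "i \<in> {0..3*n+r} - (*) 3 ` {0..n}"
      have "\<not> 3 dvd i"
      proof
        assume "3 dvd i"
        then obtain j where "i = 3 * j" by (auto elim: dvdE)
        with i assms show False by auto
      qed
      thus "cube g $ i * f $ (3*n+r-i) = 0" by (simp add: cube_nth)
    qed
  qed auto
  also have "\<dots> = (\<Sum>i\<in>{0..n}. cube g $ (3*i) * f $ (3*n+r-3*i))"
    by (subst sum.reindex) (auto simp: inj_on_def)
  also have "\<dots> = (\<Sum>i\<in>{0..n}. g $ i * f $ (3*(n-i)+r))"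
    by (intro sum.cong) (auto simp: cube_nth diff_mult_distrib2)
  also have "\<dots> = (g * sect r f) $ n"
    by (simp add: fps_mult_nth)
  finally show "sect r (cube g * f) $ n = (g * sect r f) $ n" .
qed

lemma sect_X_power:
  assumes "r < 3" "s < 3"
  shows "sect r (fps_X ^ s) = (if r = s then 1 else 0)"
  by (rule fps_ext) (use assms in \<open>auto simp: fps_X_power_nth\<close>)

section \<open>Counting series of weighted sets\<close>

definition gf :: "'a set \<Rightarrow> ('a \<Rightarrow> int) \<Rightarrow> int fps" where
  "gf S w = Abs_fps (\<lambda>n. int (card {x\<in>S. w x = int n}))"

text \<open>Nonnegative weights ensure that \<open>gf\<close> misses no element, and finite fibres
  make each \<open>card\<close> a genuine count.\<close>

definition graded :: "'a set \<Rightarrow> ('a \<Rightarrow> int) \<Rightarrow> bool" where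
  "graded S w \<longleftrightarrow> (\<forall>x\<in>S. 0 \<le> w x) \<and> (\<forall>n. finite {x\<in>S. w x = int n})"

lemma gf_nth: "gf S w $ n = int (card {x\<in>S. w x = int n})"
  by (simp add: gf_def)

lemma graded_subset:
  assumes "graded T w" "S \<subseteq> T"
  shows "graded S w"
proof -
  have "finite {x\<in>S. w x = int n}" for n
    by (rule finite_subset[of _ "{x\<in>T. w x = int n}"]) (use assms in \<open>auto simp: graded_def\<close>)
  with assms show ?thesis by (auto simp: graded_def)
qed

lemma bij_betw_fibre:
  assumes "bij_betw f S T" "\<And>x. x \<in> S \<Longrightarrow> v (f x) = w x"
  shows "bij_betw f {x\<in>S. w x = n} {y\<in>T. v y = n}"
  using assms unfolding bij_betw_def inj_on_def by auto

lemma gf_bij: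
  assumes "bij_betw f S T" "\<And>x. x \<in> S \<Longrightarrow> v (f x) = w x"
  shows "gf S w = gf T v"
  by (rule fps_ext) (simp add: gf_nth bij_betw_same_card[OF bij_betw_fibre[of f S T v w, OF assms]])

lemma gf_Un:
  assumes "graded S w" "graded T w" "S \<inter> T = {}"
  shows "gf (S \<union> T) w = gf S w + gf T w"
proof (rule fps_ext)
  fix n
  have "{x \<in> S \<union> T. w x = int n} = {x\<in>S. w x = int n} \<union> {x\<in>T. w x = int n}" by auto
  moreover have "card \<dots> = card {x\<in>S. w x = int n} + card {x\<in>T. w x = int n}"
    by (rule card_Un_disjoint) (use assms in \<open>auto simp: graded_def\<close>)
  ultimately show "gf (S \<union> T) w $ n = (gf S w + gf T w) $ n" by (simp add: gf_nth)
qed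

lemma fibre_times:
  assumes "graded S w" "graded T v"
  shows "{p \<in> S \<times> T. (case p of (x, y) \<Rightarrow> w x + v y) = int n} =
    (\<Union>i\<in>{0..n}. {x\<in>S. w x = int i} \<times> {y\<in>T. v y = int (n - i)})" (is "?L = ?R")
proof
  show "?L \<subseteq> ?R"
  proof
    fix p assume p: "p \<in> ?L"
    obtain x y where [simp]: "p = (x, y)" by force
    have xy: "x \<in> S" "y \<in> T" "w x + v y = int n" using p by auto
    have "0 \<le> w x" "0 \<le> v y" using xy assms by (auto simp: graded_def)
    then obtain i where i: "w x = int i" by (metis nonneg_int_cases)
    with xy \<open>0 \<le> v y\<close> have "i \<in> {0..n}" "v y = int (n - i)" by auto
    with xy i show "p \<in> ?R" by auto
  qed
qed auto

lemma gf_times: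
  assumes "graded S w" "graded T v"
  shows "gf (S \<times> T) (\<lambda>(x, y). w x + v y) = gf S w * gf T v"
proof (rule fps_ext)
  fix n
  have "card (\<Union>i\<in>{0..n}. {x\<in>S. w x = int i} \<times> {y\<in>T. v y = int (n - i)}) =
     (\<Sum>i\<in>{0..n}. card ({x\<in>S. w x = int i} \<times> {y\<in>T. v y = int (n - i)}))"
    by (rule card_UN_disjoint) (use assms in \<open>auto simp: graded_def simp del: of_nat_diff\<close>)
  thus "gf (S \<times> T) (\<lambda>(x, y). w x + v y) $ n = (gf S w * gf T v) $ n"
    by (simp only: gf_nth fibre_times[OF assms] fps_mult_nth)
       (simp add: card_cartesian_product gf_nth del: of_nat_diff)
qed

lemma graded_times:
  assumes "graded S w" "graded T v"
  shows "graded (S \<times> T) (\<lambda>(x, y). w x + v y)"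
  unfolding graded_def fibre_times[OF assms]
  using assms by (auto simp: graded_def simp del: of_nat_diff)

lemma gf_plus_one:
  assumes "graded S w"
  shows "gf S (\<lambda>x. w x + 1) = fps_X * gf S w"
proof (rule fps_ext)
  fix n
  show "gf S (\<lambda>x. w x + 1) $ n = (fps_X * gf S w) $ n"
  proof (cases n)
    case 0
    have "{x\<in>S. w x + 1 = int 0} = {}" using assms by (auto simp: graded_def)
    thus ?thesis using 0 by (simp only: gf_nth card.empty) simp
  next
    case (Suc m)
    thus ?thesis by (simp add: gf_nth)
  qed
qed

lemma gf_scale:
  "gf S (\<lambda>x. 3 * w x) = cube (gf S w)"
proof (rule fps_ext)
  fix n
  show "gf S (\<lambda>x. 3 * w x) $ n = cube (gf S w) $ n"
  proof (cases "3 dvd n")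
    case True
    then obtain m where "n = 3 * m" by (auto elim: dvdE)
    thus ?thesis by (simp add: gf_nth cube_nth)
  next
    case False
    hence "{x\<in>S. 3 * w x = int n} = {}" by (metis (mono_tags, lifting) Collect_empty_eq dvd_triv_left int_dvd_int_iff of_nat_numeral)
    thus ?thesis using False by (simp only: gf_nth cube_nth card.empty) simp
  qed
qed

lemma graded_scale:
  assumes "graded S w" shows "graded S (\<lambda>x. 3 * w x)"
proof -
  have "finite {x\<in>S. 3 * w x = int n}" for n
  proof (rule finite_subset)
    show "{x\<in>S. 3 * w x = int n} \<subseteq> {x\<in>S. w x = int (n div 3)}" by auto
  qed (use assms in \<open>simp add: graded_def\<close>)
  with assms show ?thesis by (simp add: graded_def)
qed

section \<open>Maya diagrams and their 3-quotients\<close>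

type_synonym maya = "nat set \<times> nat set"

definition mayas :: "maya set" where
  "mayas = {(A, B). finite A \<and> finite B}"

fun charge :: "maya \<Rightarrow> int" where
  "charge (A, B) = int (card A) - int (card B)"

text \<open>At charge 0 this is the size of the partition with Frobenius coordinates
  \<open>A\<close> and \<open>B\<close>; the unit per pair is put on the elements of
  \<open>A\<close>.\<close>

fun energy :: "maya \<Rightarrow> int" where
  "energy (A, B) = (\<Sum>a\<in>A. int a + 1) + (\<Sum>b\<in>B. int b)"

text \<open>The three colors of an integer form one block of three consecutive positions, so at
  charge 0 this is the number partitioned by a 3-colored Frobenius array.\<close>

fun energy3 :: "maya \<Rightarrow> int" where
  "energy3 (A, B) = (\<Sum>a\<in>A. int (a div 3) + 1) + (\<Sum>b\<in>B. int (b div 3))"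

section \<open>Diagrams of fixed charge and their translation\<close>

definition mayas_at :: "int \<Rightarrow> maya set" where
  "mayas_at m = {p \<in> mayas. charge p = m}"

text \<open>Translation of all sites by one. \<open>A\<close> lists the occupied sites from 0
  upwards and \<open>B\<close> the empty sites below 0, so the site that arrives at 0 is occupied
  exactly if \<open>0\<close> is not in \<open>B\<close>.\<close>

fun raise :: "maya \<Rightarrow> maya" where
  "raise (A, B) = (Suc ` A \<union> (if 0 \<in> B then {} else {0}), Suc -` B)"

fun lower :: "maya \<Rightarrow> maya" where
  "lower (A, B) = (Suc -` A, Suc ` B \<union> (if 0 \<in> A then {} else {0}))"

lemma Suc_image_vimage: "Suc ` (Suc -` B) = B - {0}"
proof (rule set_eqI)
  fix n show "n \<in> Suc ` (Suc -` B) \<longleftrightarrow> n \<in> B - {0}" by (cases n) auto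
qed

lemma range_Suc: "range Suc = {0<..}"
  by (auto simp: image_iff gr0_conv_Suc)

lemma lower_raise: "lower (raise p) = p"
  by (cases p) (auto simp: range_Suc intro!: gr0I)

lemma raise_lower: "raise (lower p) = p"
  by (cases p) (auto simp: range_Suc intro!: gr0I)

lemma finite_Suc_vimage: "finite B \<Longrightarrow> finite (Suc -` B)"
  by (rule finite_vimageI) auto

lemma sum_split_zero:
  assumes "finite B"
  shows "sum g B = sum (g \<circ> Suc) (Suc -` B) + (if 0 \<in> B then g 0 else (0 :: int))"
proof -
  have "sum g (B - {0}) = sum (g \<circ> Suc) (Suc -` B)"
    unfolding Suc_image_vimage[symmetric] by (rule sum.reindex) simp
  thus ?thesis using assms by (auto simp: sum.remove)
qed

lemma raise_mayas: "p \<in> mayas \<Longrightarrow> raise p \<in> mayas"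
  by (cases p) (auto simp: mayas_def finite_Suc_vimage)

lemma lower_mayas: "p \<in> mayas \<Longrightarrow> lower p \<in> mayas"
  by (cases p) (auto simp: mayas_def finite_Suc_vimage)

lemma raise_sums:
  fixes g :: "nat \<Rightarrow> int"
  assumes "finite A"
  shows "sum g (Suc ` A \<union> (if c then {} else {0})) = sum (g \<circ> Suc) A + (if c then 0 else g 0)"
  using assms by (simp add: sum.reindex)

lemma charge_sum: "charge (A, B) = (\<Sum>a\<in>A. 1) - (\<Sum>b\<in>B. 1)"
  by simp

lemma charge_raise:
  assumes "p \<in> mayas" shows "charge (raise p) = charge p + 1"
proof -
  obtain A B where p: "p = (A, B)" "finite A" "finite B"
    using assms by (auto simp: mayas_def)
  show ?thesis
    using sum_split_zero[of B "\<lambda>_. 1"] raise_sums[of A "\<lambda>_. 1" "0 \<in> B"] p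
    unfolding p(1) raise.simps charge_sum by (auto simp: comp_def)
qed

text \<open>Each element of \<open>A\<close> gains one unit and each positive element of
  \<open>B\<close> loses one, which gives the charge. The remaining 1 is either the new element
  \<open>0\<close> of \<open>A\<close> or the element \<open>0\<close> of \<open>B\<close> that
  disappears at no loss.\<close>

lemma energy_raise:
  assumes "p \<in> mayas" shows "energy (raise p) = energy p + charge p + 1"
proof -
  obtain A B where p: "p = (A, B)" "finite A" "finite B"
    using assms by (auto simp: mayas_def)
  show ?thesis
    using sum_split_zero[of B "\<lambda>_. 1"] sum_split_zero[of B int]
      raise_sums[of A "\<lambda>a. int a + 1" "0 \<in> B"] p
    unfolding p(1) raise.simps charge_sum energy.simps by (auto simp: comp_def sum.distrib)
qed

lemma raise_bij: "bij_betw raise (mayas_at m) (mayas_at (m + 1))"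
proof (rule bij_betw_byWitness[where f' = lower])
  show "lower ` mayas_at (m + 1) \<subseteq> mayas_at m"
  proof
    fix q assume "q \<in> lower ` mayas_at (m + 1)"
    then obtain p where p: "p \<in> mayas" "charge p = m + 1" "q = lower p"
      by (auto simp: mayas_at_def)
    have "charge p = charge q + 1"
      using charge_raise[of q] p by (simp add: raise_lower lower_mayas)
    thus "q \<in> mayas_at m" using p by (simp add: mayas_at_def lower_mayas)
  qed
qed (auto simp: lower_raise raise_lower mayas_at_def raise_mayas charge_raise
    simp del: raise.simps lower.simps charge.simps)

text \<open>Iterating the translation upwards or downwards from charge 0 adds the energies 1, 2,
  ..., with total \<open>m * (m + 1) / 2\<close>. The equation is doubled to remain in the
  integers.\<close>

lemma charge_bij:
  "\<exists>f. bij_betw f (mayas_at 0) (mayas_at m) \<and>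
    (\<forall>p\<in>mayas_at 0. 2 * energy (f p) = 2 * energy p + m * (m + 1))"
proof (induction m rule: int_induct[where k = 0])
  case base
  show ?case by (rule exI[of _ "\<lambda>p. p"]) (auto simp: bij_betw_def)
next
  case (step1 m)
  then obtain f where f: "bij_betw f (mayas_at 0) (mayas_at m)"
    "\<forall>p\<in>mayas_at 0. 2 * energy (f p) = 2 * energy p + m * (m + 1)" by blast
  have mem: "f p \<in> mayas_at m" if "p \<in> mayas_at 0" for p using f(1) that by (rule bij_betwE[rule_format])
  have "bij_betw (raise \<circ> f) (mayas_at 0) (mayas_at (m + 1))"
    by (rule bij_betw_trans[OF f(1) raise_bij])
  moreover have "2 * energy ((raise \<circ> f) p) = 2 * energy p + (m + 1) * (m + 1 + 1)"
    if "p \<in> mayas_at 0" for p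
    using bspec[OF f(2) that] mem[OF that]
    by (simp add: energy_raise mayas_at_def algebra_simps del: split_paired_All)
  ultimately show ?case by blast
next
  case (step2 m)
  then obtain f where f: "bij_betw f (mayas_at 0) (mayas_at m)"
    "\<forall>p\<in>mayas_at 0. 2 * energy (f p) = 2 * energy p + m * (m + 1)" by blast
  \<comment> \<open>Downward steps use the inverse of \<open>raise\<close>, with the change of
    energy read off from \<open>energy_raise\<close> at charge \<open>m - 1\<close>.\<close>
  define g where "g = the_inv_into (mayas_at (m - 1)) raise"
  have g: "bij_betw g (mayas_at m) (mayas_at (m - 1))"
    unfolding g_def using bij_betw_the_inv_into[OF raise_bij[of "m - 1"]] by simp
  have rg: "raise (g q) = q" if "q \<in> mayas_at m" for q
    unfolding g_def using raise_bij[of "m - 1"] that f_the_inv_into_f_bij_betw by fastforce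
  have mem: "f p \<in> mayas_at m" if "p \<in> mayas_at 0" for p using f(1) that by (rule bij_betwE[rule_format])
  have memg: "g (f p) \<in> mayas_at (m - 1)" if "p \<in> mayas_at 0" for p
    using g mem[OF that] by (rule bij_betwE[rule_format])
  have "2 * energy ((g \<circ> f) p) = 2 * energy p + (m - 1) * (m - 1 + 1)" if "p \<in> mayas_at 0" for p
  proof -
    have "energy (raise (g (f p))) = energy (g (f p)) + (m - 1) + 1"
      using memg[OF that] by (simp add: energy_raise mayas_at_def)
    thus ?thesis using bspec[OF f(2) that] rg[OF mem[OF that]] by (simp add: algebra_simps)
  qed
  moreover have "bij_betw (g \<circ> f) (mayas_at 0) (mayas_at (m - 1))"
    by (rule bij_betw_trans[OF f(1) g])
  ultimately show ?case by blast
qed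

section \<open>Splitting sets and diagrams modulo 3\<close>

definition residue_part :: "nat \<Rightarrow> nat set \<Rightarrow> nat set" where
  "residue_part r A = {a. 3 * a + r \<in> A}"

lemma sum_residue_parts:
  assumes "finite A"
  shows "sum g A = (\<Sum>a\<in>residue_part 0 A. g (3 * a)) + (\<Sum>a\<in>residue_part 1 A. g (3 * a + 1)) +
    (\<Sum>a\<in>residue_part 2 A. g (3 * a + 2) :: int)"
proof -
  have im: "(\<lambda>a. 3 * a + r) ` residue_part r A = {a\<in>A. a mod 3 = r}" if "r < 3" for r
  proof
    show "{a\<in>A. a mod 3 = r} \<subseteq> (\<lambda>a. 3 * a + r) ` residue_part r A"
    proof
      fix a assume "a \<in> {a\<in>A. a mod 3 = r}"
      hence "a = 3 * (a div 3) + r" "a \<in> A" by auto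
      thus "a \<in> (\<lambda>a. 3 * a + r) ` residue_part r A"
        unfolding residue_part_def by (metis (mono_tags, lifting) image_eqI mem_Collect_eq)
    qed
  qed (use that in \<open>auto simp: residue_part_def\<close>)
  have part: "(\<Sum>a\<in>residue_part r A. g (3 * a + r)) = sum g {a\<in>A. a mod 3 = r}" if "r < 3" for r
    unfolding im[OF that, symmetric] by (subst sum.reindex) (auto simp: inj_on_def)
  have "sum g A = sum g ({a\<in>A. a mod 3 = 0} \<union> ({a\<in>A. a mod 3 = 1} \<union> {a\<in>A. a mod 3 = 2}))"
    by (rule arg_cong[of _ _ "sum g"]) auto
  also have "\<dots> = sum g {a\<in>A. a mod 3 = 0} + sum g ({a\<in>A. a mod 3 = 1} \<union> {a\<in>A. a mod 3 = 2})"
    using assms by (intro sum.union_disjoint) auto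
  also have "sum g ({a\<in>A. a mod 3 = 1} \<union> {a\<in>A. a mod 3 = 2}) =
      sum g {a\<in>A. a mod 3 = 1} + sum g {a\<in>A. a mod 3 = 2}"
    using assms by (intro sum.union_disjoint) auto
  finally show ?thesis using part[of 0] part[of 1] part[of 2] by simp
qed

lemma finite_residue_part: "finite A \<Longrightarrow> finite (residue_part r A)"
proof -
  assume "finite A"
  hence "finite ((\<lambda>a. 3 * a + r) -` A)" by (rule finite_vimageI) (auto simp: inj_on_def)
  thus ?thesis by (simp add: residue_part_def vimage_def)
qed

definition interleave :: "nat set \<Rightarrow> nat set \<Rightarrow> nat set \<Rightarrow> nat set" where
  "interleave A B C = {n. n div 3 \<in> (if n mod 3 = 0 then A else if n mod 3 = 1 then B else C)}"

lemma Suc_triple_div_mod: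
  "Suc (3 * n) div 3 = n" "Suc (3 * n) mod 3 = 1"
  "Suc (Suc (3 * n)) div 3 = n" "Suc (Suc (3 * n)) mod 3 = 2"
  by presburger+

lemma residue_part_interleave:
  "residue_part 0 (interleave A B C) = A" "residue_part 1 (interleave A B C) = B"
  "residue_part (Suc 0) (interleave A B C) = B" "residue_part 2 (interleave A B C) = C"
  by (auto simp: residue_part_def interleave_def Suc_triple_div_mod)

lemma interleave_residue_part:
  "interleave (residue_part 0 A) (residue_part 1 A) (residue_part 2 A) = A"
proof (rule set_eqI)
  fix n :: nat
  obtain k where "n = 3 * k \<or> n = Suc (3 * k) \<or> n = Suc (Suc (3 * k))"
    by (rule that[of "n div 3"]) presburger
  thus "n \<in> interleave (residue_part 0 A) (residue_part 1 A) (residue_part 2 A) \<longleftrightarrow> n \<in> A"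
    by (elim disjE) (auto simp: residue_part_def interleave_def Suc_triple_div_mod)
qed

lemma finite_interleave:
  assumes "finite A" "finite B" "finite C" shows "finite (interleave A B C)"
proof (rule finite_subset)
  show "interleave A B C \<subseteq> (\<Union>d\<in>A \<union> B \<union> C. {3*d..3*d+2})"
  proof
    fix n assume "n \<in> interleave A B C"
    hence "n div 3 \<in> A \<union> B \<union> C" by (auto simp: interleave_def split: if_splits)
    moreover have "n \<in> {3*(n div 3)..3*(n div 3)+2}" by simp
    ultimately show "n \<in> (\<Union>d\<in>A \<union> B \<union> C. {3*d..3*d+2})" by blast
  qed
qed (use assms in auto)

text \<open>Position \<open>b\<close> of the second component stands for the site \<open>-1-b\<close>, so residue \<open>r\<close> in the
  first component is paired with residue \<open>2-r\<close> in the second.\<close>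

fun quotients :: "maya \<Rightarrow> maya \<times> maya \<times> maya" where
  "quotients (A, B) = ((residue_part 0 A, residue_part 2 B), (residue_part 1 A, residue_part 1 B),
     (residue_part 2 A, residue_part 0 B))"

fun merge :: "maya \<times> maya \<times> maya \<Rightarrow> maya" where
  "merge ((A, B), (C, D), (E, F)) = (interleave A C E, interleave F D B)"

lemma quotients_bij: "bij_betw merge (mayas \<times> mayas \<times> mayas) mayas"
proof (rule bij_betw_byWitness[where f' = quotients])
  show "\<forall>p\<in>mayas \<times> mayas \<times> mayas. quotients (merge p) = p"
    by (auto simp: residue_part_interleave)
  show "\<forall>p\<in>mayas. merge (quotients p) = p"
    using interleave_residue_part by (auto simp del: One_nat_def)
  show "merge ` (mayas \<times> mayas \<times> mayas) \<subseteq> mayas"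
    by (auto simp: mayas_def finite_interleave)
  show "quotients ` mayas \<subseteq> mayas \<times> mayas \<times> mayas"
    by (auto simp: mayas_def finite_residue_part)
qed

lemma sum_interleave:
  assumes "finite A" "finite B" "finite C"
  shows "sum g (interleave A B C) =
    (\<Sum>a\<in>A. g (3 * a)) + (\<Sum>a\<in>B. g (3 * a + 1)) + (\<Sum>a\<in>C. g (3 * a + 2) :: int)"
  using sum_residue_parts[OF finite_interleave[OF assms], of g]
  by (simp add: residue_part_interleave)

text \<open>An element \<open>3 * a + r\<close> of the first set weighs
  \<open>3 * (a + 1) - (2 - r)\<close>, and its partner \<open>3 * b + (2 - r)\<close> in the second
  weighs just that. So the energy is corrected by \<open>2 - r\<close> times the charge of the
  quotient of residue \<open>r\<close>, whereas \<open>energy3\<close> sees only the blocks and gets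
  no correction.\<close>

lemma merge_weights:
  assumes "p \<in> mayas" "q \<in> mayas" "s \<in> mayas"
  shows "charge (merge (p, q, s)) = charge p + charge q + charge s"
    and "energy3 (merge (p, q, s)) = energy p + energy q + energy s"
    and "energy (merge (p, q, s)) = 3 * (energy p + energy q + energy s)
      - 2 * charge p - charge q"
proof -
  obtain A B C D E F where pqs: "p = (A, B)" "q = (C, D)" "s = (E, F)"
    by (cases p, cases q, cases s) auto
  have fin: "finite A" "finite B" "finite C" "finite D" "finite E" "finite F"
    using assms by (auto simp: mayas_def pqs)
  show "charge (merge (p, q, s)) = charge p + charge q + charge s"
    unfolding pqs merge.simps charge_sum using fin by (simp only: sum_interleave)
  show "energy3 (merge (p, q, s)) = energy p + energy q + energy s"
    unfolding pqs merge.simps energy.simps energy3.simps using fin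
    by (simp add: sum_interleave Suc_triple_div_mod)
  show "energy (merge (p, q, s)) = 3 * (energy p + energy q + energy s)
      - 2 * charge p - charge q"
    unfolding pqs merge.simps energy.simps charge_sum using fin
    by (simp only: sum_interleave) (simp add: sum.distrib sum_distrib_left[symmetric] sum_distrib_right[symmetric] algebra_simps)
qed

text \<open>A neutral diagram amounts to three neutral diagrams and three charges with sum 0. Both
  weights are computed for the same bijection: \<open>energy3\<close> leads to the colored
  partitions, \<open>energy\<close> to the decomposition of a partition into 3-core and
  3-quotient.\<close>

lemma sum_zero_charges:
  "\<exists>f. bij_betw f ((UNIV :: (int \<times> int) set) \<times> (mayas_at 0 \<times> mayas_at 0 \<times> mayas_at 0)) (mayas_at 0) \<and>
    (\<forall>x y. \<forall>p\<in>mayas_at 0. \<forall>q\<in>mayas_at 0. \<forall>s\<in>mayas_at 0.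
      energy3 (f ((x, y), (p, q, s))) = x\<^sup>2 + x * y + y\<^sup>2 + (energy p + (energy q + energy s)) \<and>
      energy (f ((x, y), (p, q, s))) =
        3 * (x\<^sup>2 + x * y + y\<^sup>2) - x + y + 3 * (energy p + (energy q + energy s)))"
proof -
  from charge_bij obtain \<phi> where \<phi>: "\<And>m. bij_betw (\<phi> m) (mayas_at 0) (mayas_at m)"
    "\<And>m p. p \<in> mayas_at 0 \<Longrightarrow> 2 * energy (\<phi> m p) = 2 * energy p + m * (m + 1)" by metis
  let ?M = "mayas_at 0 \<times> mayas_at 0 \<times> mayas_at 0"
  let ?T = "{(p, q, s). p \<in> mayas \<and> q \<in> mayas \<and> s \<in> mayas \<and> charge p + charge q + charge s = 0}"
  \<comment> \<open>Two integers describe the charges, since the middle one must be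
    \<open>- x - y\<close>.\<close>
  let ?g = "\<lambda>((x, y), (p, q, s)). (\<phi> x p, \<phi> (- x - y) q, \<phi> y s)"
  have mem: "\<phi> m p \<in> mayas" "charge (\<phi> m p) = m" if "p \<in> mayas_at 0" for m p
    using bspec[OF bij_betwE[OF \<phi>(1)[of m]] that] by (auto simp: mayas_at_def)
  have inj: "p = q" if "\<phi> m p = \<phi> m q" "p \<in> mayas_at 0" "q \<in> mayas_at 0" for m p q
    using \<phi>(1)[of m] that by (auto simp: bij_betw_def inj_on_def)
  have g: "bij_betw ?g (UNIV \<times> ?M) ?T"
    unfolding bij_betw_def
  proof
    show "inj_on ?g (UNIV \<times> ?M)"
    proof (rule inj_onI)
      fix t t' assume t: "t \<in> UNIV \<times> ?M" "t' \<in> UNIV \<times> ?M" "?g t = ?g t'"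
      obtain x y p q s where t1: "t = ((x, y), (p, q, s))" by (metis surj_pair)
      obtain x' y' p' q' s' where t2: "t' = ((x', y'), (p', q', s'))" by (metis surj_pair)
      have m: "p \<in> mayas_at 0" "q \<in> mayas_at 0" "s \<in> mayas_at 0"
        "p' \<in> mayas_at 0" "q' \<in> mayas_at 0" "s' \<in> mayas_at 0"
        using t by (simp_all add: t1 t2)
      have eq: "\<phi> x p = \<phi> x' p'" "\<phi> (- x - y) q = \<phi> (- x' - y') q'" "\<phi> y s = \<phi> y' s'"
        using t by (simp_all add: t1 t2)
      have xy: "x = x'" "y = y'" using eq(1,3) mem(2) m by metis+
      have "p = p'" "q = q'" "s = s'"
        using inj[OF eq(1)[folded xy]] inj[OF eq(2)[folded xy]] inj[OF eq(3)[folded xy]] m by auto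
      thus "t = t'" by (simp add: t1 t2 xy)
    qed
    show "?g ` (UNIV \<times> ?M) = ?T"
    proof
      show "?g ` (UNIV \<times> ?M) \<subseteq> ?T" using mem by auto
      show "?T \<subseteq> ?g ` (UNIV \<times> ?M)"
      proof clarify
        fix p q s :: maya
        assume m: "p \<in> mayas" "q \<in> mayas" "s \<in> mayas" and c: "charge p + charge q + charge s = 0"
        have ex: "\<exists>u\<in>mayas_at 0. \<phi> (charge v) u = v" if "v \<in> mayas" for v
        proof -
          have "v \<in> mayas_at (charge v)" using that by (simp add: mayas_at_def)
          thus ?thesis using bij_betw_imp_surj_on[OF \<phi>(1)[of "charge v"]] by (metis imageE)
        qed
        obtain p' q' s' where "p' \<in> mayas_at 0" "q' \<in> mayas_at 0" "s' \<in> mayas_at 0"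
          "\<phi> (charge p) p' = p" "\<phi> (charge q) q' = q" "\<phi> (charge s) s' = s"
          using ex m by meson
        moreover have "charge q = - charge p - charge s" using c by simp
        ultimately show "(p, q, s) \<in> ?g ` (UNIV \<times> ?M)"
          by (intro image_eqI[of _ _ "((charge p, charge s), (p', q', s'))"]) auto
      qed
    qed
  qed
  have h: "bij_betw merge ?T (mayas_at 0)"
  proof -
    have "bij_betw merge {t \<in> mayas \<times> mayas \<times> mayas. charge (merge t) = 0} {p\<in>mayas. charge p = 0}"
      by (rule bij_betw_fibre[OF quotients_bij refl])
    moreover have "{t \<in> mayas \<times> mayas \<times> mayas. charge (merge t) = 0} = ?T"
      using merge_weights(1) by auto
    ultimately show ?thesis by (simp add: mayas_at_def)
  qed
  have bij: "bij_betw (merge \<circ> ?g) (UNIV \<times> ?M) (mayas_at 0)"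
    by (rule bij_betw_trans[OF g h])
  have val: "energy3 ((merge \<circ> ?g) ((x, y), (p, q, s))) = x\<^sup>2 + x * y + y\<^sup>2 + (energy p + (energy q + energy s)) \<and>
      energy ((merge \<circ> ?g) ((x, y), (p, q, s))) =
        3 * (x\<^sup>2 + x * y + y\<^sup>2) - x + y + 3 * (energy p + (energy q + energy s))"
    if m: "p \<in> mayas_at 0" "q \<in> mayas_at 0" "s \<in> mayas_at 0" for x y p q s
  proof -
    \<comment> \<open>The ground energies \<open>m * (m + 1) / 2\<close> for
      \<open>m = x, - x - y, y\<close> add up to the quadratic form; their linear parts
      cancel.\<close>
    have e: "2 * (energy (\<phi> x p) + energy (\<phi> (- x - y) q) + energy (\<phi> y s)) =
        2 * (x\<^sup>2 + x * y + y\<^sup>2 + (energy p + (energy q + energy s)))"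
      using \<phi>(2)[OF m(1), of x] \<phi>(2)[OF m(2), of "- x - y"] \<phi>(2)[OF m(3), of y]
      by (simp add: algebra_simps power2_eq_square)
    hence e: "energy (\<phi> x p) + energy (\<phi> (- x - y) q) + energy (\<phi> y s) =
        x\<^sup>2 + x * y + y\<^sup>2 + (energy p + (energy q + energy s))" by (simp only: mult_cancel_left) simp
    show ?thesis
      using merge_weights(2,3)[of "\<phi> x p" "\<phi> (- x - y) q" "\<phi> y s"] mem m e
      by (simp add: algebra_simps)
  qed
  show ?thesis
    by (rule exI[of _ "merge \<circ> ?g"], rule conjI[OF bij], intro allI ballI, rule val)
qed

section \<open>Theta series of the Eisenstein form\<close>

lemma energy3_bound:
  assumes "p \<in> mayas" "p = (A, B)"
  shows "a \<in> A \<Longrightarrow> int (a div 3) \<le> energy3 p" "b \<in> B \<Longrightarrow> int (b div 3) \<le> energy3 p"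
    "0 \<le> energy3 p" "energy3 p \<le> energy p"
proof -
  have fin: "finite A" "finite B" using assms by (auto simp: mayas_def)
  have nn: "0 \<le> (\<Sum>a\<in>A. int (a div 3) + 1)" "0 \<le> (\<Sum>b\<in>B. int (b div 3))"
    by (intro sum_nonneg; simp)+
  show "a \<in> A \<Longrightarrow> int (a div 3) \<le> energy3 p"
    using member_le_sum[of a A "\<lambda>a. int (a div 3) + 1"] fin nn assms by auto
  show "b \<in> B \<Longrightarrow> int (b div 3) \<le> energy3 p"
    using member_le_sum[of b B "\<lambda>a. int (a div 3)"] fin nn assms by auto
  show "0 \<le> energy3 p" using nn assms by simp
  have "(\<Sum>a\<in>A. int (a div 3) + 1) \<le> (\<Sum>a\<in>A. int a + 1)" "(\<Sum>b\<in>B. int (b div 3)) \<le> (\<Sum>b\<in>B. int b)"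
    by (intro sum_mono; simp)+
  thus "energy3 p \<le> energy p" using assms by simp
qed

text \<open>A bound \<open>n\<close> on \<open>energy3\<close> bounds every block number, hence
  confines both sets to \<open>{..3*n+2}\<close>.\<close>

lemma finite_bounded_mayas: "finite {p \<in> mayas. energy3 p \<le> int n}"
proof (rule finite_subset)
  show "{p \<in> mayas. energy3 p \<le> int n} \<subseteq> Pow {..3*n+2} \<times> Pow {..3*n+2}"
  proof
    fix p assume p: "p \<in> {p \<in> mayas. energy3 p \<le> int n}"
    obtain A B where AB: "p = (A, B)" by force
    have "a \<le> 3 * n + 2" if "int (a div 3) \<le> int n" for a using that by linarith
    moreover have "int (a div 3) \<le> int n" if "a \<in> A \<or> a \<in> B" for a
      using energy3_bound(1,2)[of p A B a] p AB that by fastforce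
    ultimately show "p \<in> Pow {..3*n+2} \<times> Pow {..3*n+2}" by (auto simp: AB)
  qed
qed auto

lemma graded_energy3: "graded (mayas_at 0) energy3"
proof -
  have "finite {p\<in>mayas_at 0. energy3 p = int n}" for n
    by (rule finite_subset[OF _ finite_bounded_mayas[of n]]) (auto simp: mayas_at_def)
  moreover have "0 \<le> energy3 p" if "p \<in> mayas_at 0" for p
    using that energy3_bound(3)[of p] by (cases p) (auto simp: mayas_at_def simp del: energy3.simps)
  ultimately show ?thesis by (simp add: graded_def del: energy3.simps split_paired_All)
qed

lemma graded_energy: "graded (mayas_at 0) energy"
proof -
  have le: "0 \<le> energy3 p \<and> energy3 p \<le> energy p" if "p \<in> mayas_at 0" for p
    using that energy3_bound(3,4)[of p] by (cases p) (auto simp: mayas_at_def simp del: energy3.simps energy.simps)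
  have "finite {p\<in>mayas_at 0. energy p = int n}" for n
    by (rule finite_subset[OF _ finite_bounded_mayas[of n]])
       (use le in \<open>force simp: mayas_at_def simp del: energy3.simps energy.simps split_paired_All\<close>)
  moreover have "0 \<le> energy p" if "p \<in> mayas_at 0" for p using le[OF that] by simp
  ultimately show ?thesis by (simp add: graded_def del: energy.simps split_paired_All)
qed

definition partition_gf :: "int fps" where
  "partition_gf = gf (mayas_at 0) energy"

definition eis :: "int \<times> int \<Rightarrow> int" where
  "eis = (\<lambda>(x, y). x\<^sup>2 + x * y + y\<^sup>2)"

text \<open>The size of the 3-core with quotient charges \<open>x\<close>, \<open>- x - y\<close>,
  \<open>y\<close>.\<close>

definition core :: "int \<times> int \<Rightarrow> int" where
  "core = (\<lambda>(x, y). 3 * eis (x, y) - x + y)"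

lemma square_bound: "\<bar>x\<bar> \<le> n" if "x\<^sup>2 \<le> n" for x n :: int
proof -
  have "\<bar>x\<bar> * 1 \<le> \<bar>x\<bar> * \<bar>x\<bar>" by (cases "x = 0") (auto intro!: mult_left_mono simp del: abs_mult_self_eq)
  thus ?thesis using that by (simp add: power2_eq_square)
qed

lemma graded_by_squares:
  assumes "\<And>x y. x\<^sup>2 + y\<^sup>2 \<le> 2 * w (x, y)"
  shows "graded (UNIV :: (int \<times> int) set) w"
proof -
  have b: "\<bar>x\<bar> \<le> 2 * w (x, y) \<and> \<bar>y\<bar> \<le> 2 * w (x, y)" for x y
    using assms[of x y] square_bound[of x "2 * w (x, y)"] square_bound[of y "2 * w (x, y)"]
    by (smt (verit) zero_le_power2)
  have "finite {p\<in>UNIV. w p = int n}" for n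
  proof (rule finite_subset)
    show "{p\<in>UNIV. w p = int n} \<subseteq> {-2*int n..2*int n} \<times> {-2*int n..2*int n}"
    proof
      fix p assume p: "p \<in> {p\<in>UNIV. w p = int n}"
      obtain x y where [simp]: "p = (x, y)" by force
      show "p \<in> {-2*int n..2*int n} \<times> {-2*int n..2*int n}"
        using b[of x y] p by auto
    qed
  qed auto
  moreover have "0 \<le> w p" for p using b[of "fst p" "snd p"] by auto
  ultimately show ?thesis unfolding graded_def by blast
qed

lemma graded_eis: "graded UNIV eis"
proof (rule graded_by_squares)
  fix x y :: int
  have "2 * eis (x, y) = x\<^sup>2 + y\<^sup>2 + (x + y)\<^sup>2"
    by (simp add: eis_def power2_eq_square algebra_simps)
  thus "x\<^sup>2 + y\<^sup>2 \<le> 2 * eis (x, y)" by simp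
qed

lemma graded_core: "graded UNIV core"
proof (rule graded_by_squares)
  fix x y :: int
  have "x \<le> x\<^sup>2" "- y \<le> y\<^sup>2"
    using square_bound[of x "x\<^sup>2"] square_bound[of y "y\<^sup>2"] by linarith+
  moreover have "2 * core (x, y) = 3 * (x + y)\<^sup>2 + 3 * x\<^sup>2 + 3 * y\<^sup>2 - 2 * x + 2 * y"
    by (simp add: core_def eis_def power2_eq_square algebra_simps)
  ultimately show "x\<^sup>2 + y\<^sup>2 \<le> 2 * core (x, y)"
    using zero_le_power2[of "x + y"] by linarith
qed

definition theta :: "int fps" where
  "theta = gf UNIV eis"

definition core_gf :: "int fps" where
  "core_gf = gf UNIV core"

abbreviation "neutral3 \<equiv> mayas_at 0 \<times> mayas_at 0 \<times> mayas_at 0"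

lemma gf_neutral3:
  "gf neutral3 (\<lambda>(p, q, s). energy p + (energy q + energy s)) = partition_gf ^ 3"
  "graded neutral3 (\<lambda>(p, q, s). energy p + (energy q + energy s))"
proof -
  have eq: "(\<lambda>(p, q, s). energy p + (energy q + energy s)) =
    (\<lambda>(p, r). energy p + (\<lambda>(q, s). energy q + energy s) r)" by auto
  show "gf neutral3 (\<lambda>(p, q, s). energy p + (energy q + energy s)) = partition_gf ^ 3"
    unfolding eq
    by (subst gf_times[OF graded_energy graded_times[OF graded_energy graded_energy]],
        subst gf_times[OF graded_energy graded_energy])
       (simp add: partition_gf_def power3_eq_cube mult_ac)
  show "graded neutral3 (\<lambda>(p, q, s). energy p + (energy q + energy s))"
    unfolding eq by (intro graded_times graded_energy)
qed

lemma gf_theta_times: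
  assumes "graded S w" "\<And>t p q s. v (t, p, q, s) = w t + k * (energy p + (energy q + energy s))"
    "k = 1 \<or> k = 3"
  shows "gf (S \<times> neutral3) v = gf S w * (if k = 1 then partition_gf ^ 3 else cube (partition_gf ^ 3))"
proof -
  let ?u = "\<lambda>(p, q, s). energy p + (energy q + energy s)"
  have "v = (\<lambda>(t, r). w t + k * ?u r)" using assms(2) by auto
  moreover have "graded neutral3 (\<lambda>r. k * ?u r)"
    using assms(3) gf_neutral3(2) graded_scale[OF gf_neutral3(2)] by auto
  ultimately have "gf (S \<times> neutral3) v = gf S w * gf neutral3 (\<lambda>r. k * ?u r)"
    using gf_times[OF assms(1)] by simp
  thus ?thesis using assms(3) gf_neutral3(1) gf_scale[of neutral3 ?u] by auto
qed

abbreviation residue_class :: "int \<Rightarrow> (int \<times> int) set" where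
  "residue_class i \<equiv> {t. (snd t - fst t) mod 3 = i}"

text \<open>One bijection is read with two weights. The third identity holds since
  \<open>core (x, y)\<close> is congruent to \<open>y - x\<close> modulo 3 and the quotients
  contribute multiples of 3, so a condition on \<open>energy\<close> modulo 3 restricts only the
  lattice vector.\<close>

lemma frobenius_product:
  "gf (mayas_at 0) energy3 = theta * partition_gf ^ 3"
  "partition_gf = core_gf * cube partition_gf ^ 3"
  "gf {p \<in> mayas_at 0. energy p mod 3 = i} energy3 = gf (residue_class i) eis * partition_gf ^ 3"
proof -
  obtain f where f: "bij_betw f (UNIV \<times> neutral3) (mayas_at 0)" and
    v: "\<And>x y p q s. p \<in> mayas_at 0 \<Longrightarrow> q \<in> mayas_at 0 \<Longrightarrow> s \<in> mayas_at 0 \<Longrightarrow>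
      energy3 (f ((x, y), (p, q, s))) = eis (x, y) + (energy p + (energy q + energy s)) \<and>
      energy (f ((x, y), (p, q, s))) = core (x, y) + 3 * (energy p + (energy q + energy s))"
    using sum_zero_charges unfolding eis_def core_def prod.case by metis
  define v3 where "v3 = (\<lambda>(t, p, q, s). eis t + 1 * (energy p + (energy q + energy s)))"
  define v1 where "v1 = (\<lambda>(t, p, q, s). core t + 3 * (energy p + (energy q + energy s)))"
  have v3: "energy3 (f t) = v3 t" and v1: "energy (f t) = v1 t" if "t \<in> UNIV \<times> neutral3" for t
    using that v unfolding v1_def v3_def by auto
  have "gf (UNIV \<times> neutral3) v3 = gf (mayas_at 0) energy3"
    by (rule gf_bij[of f]) (fact f, fact v3)
  thus "gf (mayas_at 0) energy3 = theta * partition_gf ^ 3"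
    using gf_theta_times[OF graded_eis, of v3 1] by (simp add: v3_def theta_def)
  have "gf (UNIV \<times> neutral3) v1 = gf (mayas_at 0) energy"
    by (rule gf_bij[of f]) (fact f, fact v1)
  thus "partition_gf = core_gf * cube partition_gf ^ 3"
    using gf_theta_times[OF graded_core, of v1 3]
    by (simp add: v1_def core_gf_def partition_gf_def cube_power)
  have "bij_betw f {t \<in> UNIV \<times> neutral3. v1 t mod 3 = i} {p \<in> mayas_at 0. energy p mod 3 = i}"
    by (rule bij_betw_fibre[OF f]) (simp add: v1)
  moreover have "{t \<in> UNIV \<times> neutral3. v1 t mod 3 = i} = residue_class i \<times> neutral3"
  proof -
    have "(core (x, y) + 3 * k) mod 3 = (y - x) mod 3" for x y k
    proof -
      have "core (x, y) + 3 * k = (y - x) + 3 * (eis (x, y) + k)" by (simp add: core_def)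
      thus ?thesis by (simp only: mod_mult_self2)
    qed
    thus ?thesis by (auto simp: v1_def simp del: energy.simps distrib_left_numeral)
  qed
  ultimately have "gf (residue_class i \<times> neutral3) v3 = gf {p \<in> mayas_at 0. energy p mod 3 = i} energy3"
    by (intro gf_bij[of f]) (auto simp: v3)
  thus "gf {p \<in> mayas_at 0. energy p mod 3 = i} energy3 = gf (residue_class i) eis * partition_gf ^ 3"
    using gf_theta_times[of "residue_class i" eis v3 1] graded_subset[OF graded_eis subset_UNIV]
    by (simp add: v3_def)
qed

text \<open>The sublattice is the image of the whole lattice under a similarity that multiplies the
  form by 3, as multiplication by a square root of -3 does on the Eisenstein integers.\<close>

lemma gf_residue_class_0: "gf (residue_class 0) eis = cube theta"
proof -
  have "bij_betw (\<lambda>(u, k). (u - k, u + 2 * k)) UNIV (residue_class 0)"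
  proof (rule bij_betw_byWitness[where f' = "\<lambda>(x, y). (x + (y - x) div 3, (y - x) div 3)"])
    show "\<forall>t\<in>residue_class 0. (\<lambda>(u, k). (u - k, u + 2 * k)) ((\<lambda>(x, y). (x + (y - x) div 3, (y - x) div 3)) t) = t"
      by auto
  qed auto
  hence "gf UNIV (\<lambda>t. 3 * eis t) = gf (residue_class 0) eis"
    by (rule gf_bij) (auto simp: eis_def power2_eq_square algebra_simps)
  thus ?thesis using gf_scale[of UNIV eis] by (simp add: theta_def)
qed

lemma gf_residue_class_swap: "gf (residue_class 1) eis = gf (residue_class 2) eis"
proof (rule gf_bij[of "\<lambda>(x, y). (y, x)"])
  show "bij_betw (\<lambda>(x, y). (y, x)) (residue_class 1) (residue_class 2)"
  proof (rule bij_betw_byWitness[where f' = "\<lambda>(x, y). (y, x)"])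
    show "(\<lambda>(x, y). (y, x)) ` residue_class 1 \<subseteq> residue_class 2" by auto presburger
    show "(\<lambda>(x, y). (y, x)) ` residue_class 2 \<subseteq> residue_class 1" by auto presburger
  qed auto
qed (auto simp: eis_def algebra_simps)

text \<open>The three parts of the residue class are permuted by the rotation \<open>(x, y) \<mapsto> (-x-y, x)\<close>
  of order three, under which the quadratic form is invariant.\<close>

lemma gf_residue_class_2: "gf (residue_class 2) eis = 3 * fps_X * cube core_gf"
proof -
  define S where "S i = {t \<in> residue_class 2. fst t mod 3 = i}" for i
  have gr: "graded T eis" for T by (rule graded_subset[OF graded_eis]) simp
  have "gf UNIV (\<lambda>t. 3 * core t + 1) = fps_X * gf UNIV (\<lambda>t. 3 * core t)"
    by (rule gf_plus_one[OF graded_scale[OF graded_core]])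
  hence base: "gf UNIV (\<lambda>t. 3 * core t + 1) = fps_X * cube core_gf"
    by (simp add: gf_scale core_gf_def)
  \<comment> \<open>On these vectors the form equals \<open>3 * core (x, y) + 1\<close>. The maps
    onto \<open>S 0\<close> and \<open>S 1\<close> below are this map followed by one and two
    rotations.\<close>
  have "bij_betw (\<lambda>(x, y). (3 * x - 1, 3 * y + 1)) UNIV (S 2)"
    unfolding S_def
    by (rule bij_betw_byWitness[where f' = "\<lambda>(x, y). ((x + 1) div 3, (y - 1) div 3)"])
       (auto split: prod.splits, presburger+)
  hence 2: "gf (S 2) eis = fps_X * cube core_gf"
    unfolding base[symmetric]
    by (rule gf_bij[symmetric]) (auto simp: eis_def core_def power2_eq_square algebra_simps)
  have "bij_betw (\<lambda>(x, y). (- 3 * x - 3 * y, 3 * x - 1)) UNIV (S 0)"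
    unfolding S_def
    by (rule bij_betw_byWitness[where f' = "\<lambda>(x, y). ((y + 1) div 3, - ((y + 1) div 3) - x div 3)"])
       (auto split: prod.splits, presburger+)
  hence 0: "gf (S 0) eis = fps_X * cube core_gf"
    unfolding base[symmetric]
    by (rule gf_bij[symmetric]) (auto simp: eis_def core_def power2_eq_square algebra_simps)
  have "bij_betw (\<lambda>(x, y). (3 * y + 1, - 3 * x - 3 * y)) UNIV (S 1)"
    unfolding S_def
    by (rule bij_betw_byWitness[where f' = "\<lambda>(x, y). (- (y div 3) - (x - 1) div 3, (x - 1) div 3)"])
       (auto split: prod.splits, presburger+)
  hence 1: "gf (S 1) eis = fps_X * cube core_gf"
    unfolding base[symmetric]
    by (rule gf_bij[symmetric]) (auto simp: eis_def core_def power2_eq_square algebra_simps)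
  have "residue_class 2 = S 0 \<union> (S 1 \<union> S 2)" unfolding S_def by auto
  also have "gf \<dots> eis = gf (S 0) eis + (gf (S 1) eis + gf (S 2) eis)"
    by (subst gf_Un[OF gr gr], force simp: S_def, subst gf_Un[OF gr gr], force simp: S_def) simp
  finally show ?thesis using 0 1 2 by simp
qed

lemma theta_dissection: "theta = cube theta + 6 * fps_X * cube core_gf"
proof -
  have gr: "graded T eis" for T by (rule graded_subset[OF graded_eis]) simp
  have "UNIV = residue_class 0 \<union> (residue_class 1 \<union> residue_class 2)" by auto
  hence "theta = gf (residue_class 0 \<union> (residue_class 1 \<union> residue_class 2)) eis"
    by (simp add: theta_def)
  also have "\<dots> = gf (residue_class 0) eis + (gf (residue_class 1) eis + gf (residue_class 2) eis)"
    by (subst gf_Un[OF gr gr], force, subst gf_Un[OF gr gr], force) simp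
  finally show ?thesis
    by (simp add: gf_residue_class_0 gf_residue_class_swap gf_residue_class_2 mult.assoc)
qed

section \<open>Rotating incomplete colour blocks\<close>

definition block :: "nat set \<Rightarrow> nat \<Rightarrow> nat set" where
  "block A k = {a\<in>A. a div 3 = k}"

definition partial_at :: "nat set \<Rightarrow> nat \<Rightarrow> bool" where
  "partial_at A k \<longleftrightarrow> card (block A k) \<in> {1, 2}"

definition rot :: "nat \<Rightarrow> nat \<Rightarrow> nat \<Rightarrow> nat" where
  "rot k j a = (if a div 3 = k then 3 * k + (a + j) mod 3 else a)"

definition first_partial :: "nat set \<Rightarrow> nat" where
  "first_partial A = (LEAST k. partial_at A k)"

definition turn :: "nat set \<Rightarrow> nat set" where
  "turn A = rot (first_partial A) (card (block A (first_partial A))) ` A"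

lemma rot_div [simp]: "rot k j a div 3 = a div 3"
  by (simp add: rot_def)

lemma rot_mod: "int (rot k j a) mod 3 = (int a + (if a div 3 = k then int j else 0)) mod 3"
  by (simp add: rot_def zmod_int)

lemma inj_rot: "inj (rot k j)"
proof (rule injI)
  fix a b assume eq: "rot k j a = rot k j b"
  hence d: "a div 3 = b div 3" using rot_div by metis
  define c where "c = (if a div 3 = k then int j else 0)"
  have "(int a + c) mod 3 = (int b + c) mod 3"
    using rot_mod[of k j a] rot_mod[of k j b] eq d by (simp add: c_def)
  hence "a mod 3 = b mod 3" by presburger
  with d show "a = b" by (metis div_mult_mod_eq)
qed

lemma card_block_rot: "card (block (rot k j ` A) l) = card (block A l)"
proof -
  have "block (rot k j ` A) l = rot k j ` block A l"
    by (auto simp: block_def)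
  thus ?thesis using card_image[OF inj_on_subset[OF inj_rot subset_UNIV]] by metis
qed

lemma partial_at_turn: "partial_at (turn A) = partial_at A"
  by (rule ext) (simp add: partial_at_def turn_def card_block_rot)

text \<open>Rotation keeps all block sizes, so the image reveals both the rotated block and the
  number of steps, and a fixed rotation is injective.\<close>

lemma inj_turn: "inj turn"
proof (rule injI)
  fix A B assume eq: "turn A = turn B"
  have "first_partial A = first_partial B"
    unfolding first_partial_def using partial_at_turn eq by metis
  moreover have "card (block A k) = card (block B k)" for k
    using eq card_block_rot unfolding turn_def by metis
  ultimately show "A = B" using eq inj_image_eq_iff[OF inj_rot] unfolding turn_def by simp
qed

lemma sum_turn:
  fixes g :: "nat \<Rightarrow> int"
  shows "sum g (turn A) = (\<Sum>a\<in>A. g (rot (first_partial A) (card (block A (first_partial A))) a))"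
  unfolding turn_def by (subst sum.reindex[OF inj_on_subset[OF inj_rot subset_UNIV]]) simp

lemma sum_turn_div: "(\<Sum>a\<in>turn A. g (a div 3)) = (\<Sum>a\<in>A. g (a div 3) :: int)"
  by (simp add: sum_turn)

lemma finite_turn: "finite A \<Longrightarrow> finite (turn A)"
  by (simp add: turn_def)

text \<open>Rotating a block of \<open>j\<close> elements by \<open>j\<close> steps changes the sum by \<open>j\<^sup>2 \<equiv> 1\<close>, since
  \<open>j\<close> is 1 or 2.\<close>

lemma sum_turn_mod:
  assumes "finite A" "partial_at A k"
  shows "(\<Sum>a\<in>turn A. int a) mod 3 = ((\<Sum>a\<in>A. int a) + 1) mod 3"
proof -
  define f j where "f = first_partial A" and "j = card (block A f)"
  have "partial_at A f" unfolding f_def first_partial_def using assms(2) by (rule LeastI)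
  hence j: "j = 1 \<or> j = 2" by (simp add: partial_at_def j_def)
  have "(\<Sum>a\<in>turn A. int a) mod 3 = (\<Sum>a\<in>A. int (rot f j a) mod 3) mod 3"
    by (simp add: sum_turn f_def j_def mod_sum_eq)
  also have "\<dots> = (\<Sum>a\<in>A. int a + (if a div 3 = f then int j else 0)) mod 3"
    by (simp add: rot_mod mod_sum_eq)
  also have "(\<Sum>a\<in>A. int a + (if a div 3 = f then int j else 0)) = (\<Sum>a\<in>A. int a) + int j * int j"
    using assms(1) by (simp add: sum.distrib sum.inter_filter[symmetric] j_def block_def)
  also have "\<dots> mod 3 = ((\<Sum>a\<in>A. int a) + 1) mod 3"
    using j by (auto simp: mod_add_eq) presburger
  finally show ?thesis .
qed

definition partial :: "maya \<Rightarrow> bool" where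
  "partial p \<longleftrightarrow> (\<exists>k. partial_at (fst p) k \<or> partial_at (snd p) k)"

definition twist :: "maya \<Rightarrow> maya" where
  "twist p = (if \<exists>k. partial_at (fst p) k then (turn (fst p), snd p) else (fst p, turn (snd p)))"

text \<open>Turning moves positions only inside a block, so cardinalities and \<open>energy3\<close>
  persist, while the energy modulo 3 advances by 1.\<close>

lemma twist:
  assumes "p \<in> mayas_at 0" "partial p"
  shows "twist p \<in> mayas_at 0" "partial (twist p)" "energy3 (twist p) = energy3 p"
    "energy (twist p) mod 3 = (energy p + 1) mod 3"
proof -
  obtain A B where p: "p = (A, B)" "finite A" "finite B" "int (card A) - int (card B) = 0"
    using assms(1) by (auto simp: mayas_at_def mayas_def)
  have c: "int (card (turn C)) = int (card C)" for C using sum_turn_div[of "\<lambda>_. 1" C] by simp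
  have e: "energy (C, D) = (\<Sum>a\<in>C. int a) + int (card C) + (\<Sum>b\<in>D. int b)" for C D
    by (simp add: sum.distrib)
  show "twist p \<in> mayas_at 0"
    using p c by (auto simp: twist_def mayas_at_def mayas_def finite_turn)
  show "partial (twist p)"
    using assms(2) by (auto simp: twist_def partial_def partial_at_turn)
  show "energy3 (twist p) = energy3 p"
    using p by (simp add: twist_def sum_turn_div[of "\<lambda>a. int a + 1"] sum_turn_div[of "\<lambda>a. int a"])
  show "energy (twist p) mod 3 = (energy p + 1) mod 3"
  proof (cases "\<exists>k. partial_at A k")
    case True
    then obtain k where k: "partial_at A k" by blast
    have "(sum int (turn A) + (int (card A) + sum int B)) mod 3 = (sum int A + 1 + (int (card A) + sum int B)) mod 3"
      using sum_turn_mod[OF p(2) k] by (rule mod_add_cong) simp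
    thus ?thesis using True by (simp add: twist_def p(1) e c add_ac del: energy.simps)
  next
    case False
    then obtain k where k: "partial_at B k" using assms(2) by (auto simp: p(1) partial_def)
    have "(sum int (turn B) + (int (card A) + sum int A)) mod 3 = (sum int B + 1 + (int (card A) + sum int A)) mod 3"
      using sum_turn_mod[OF p(3) k] by (rule mod_add_cong) simp
    thus ?thesis using False by (simp add: twist_def p(1) e c add_ac del: energy.simps)
  qed
qed

lemma inj_twist: "inj twist"
proof (rule injI)
  fix p q assume eq: "twist p = twist q"
  have "(\<exists>k. partial_at (fst (twist p)) k) \<longleftrightarrow> (\<exists>k. partial_at (fst p) k)" for p
    by (simp add: twist_def partial_at_turn)
  hence same: "(\<exists>k. partial_at (fst p) k) = (\<exists>k. partial_at (fst q) k)" using eq by metis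
  show "p = q"
  proof (cases "\<exists>k. partial_at (fst q) k")
    case True
    hence "(turn (fst p), snd p) = (turn (fst q), snd q)"
      using eq same by (simp only: twist_def if_True)
    thus ?thesis by (simp add: prod_eq_iff inj_eq[OF inj_turn])
  next
    case False
    hence "(fst p, turn (snd p)) = (fst q, turn (snd q))"
      using eq same by (simp only: twist_def if_False)
    thus ?thesis by (simp add: prod_eq_iff inj_eq[OF inj_turn])
  qed
qed

definition partial_class :: "int \<Rightarrow> maya set" where
  "partial_class i = {p \<in> mayas_at 0. partial p \<and> energy p mod 3 = i}"

text \<open>\<open>twist\<close> injects each energy class modulo 3 into the next one. The three
  resulting inequalities between finite cardinalities close up to a cycle, so all are
  equalities.\<close>

lemma gf_partial_class: "gf (partial_class 0) energy3 = gf (partial_class 1) energy3"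
proof (rule fps_ext)
  fix n
  let ?F = "\<lambda>i. {p \<in> partial_class i. energy3 p = int n}"
  have le: "card (?F i) \<le> card (?F ((i + 1) mod 3))" for i
  proof (rule card_inj_on_le)
    show "inj_on twist (?F i)" by (rule inj_on_subset[OF inj_twist]) simp
    have "energy (twist p) mod 3 = (energy p mod 3 + 1) mod 3" if "p \<in> mayas_at 0" "partial p" for p
      using twist(4)[OF that] by (simp add: mod_add_left_eq)
    thus "twist ` ?F i \<subseteq> ?F ((i + 1) mod 3)"
      unfolding partial_class_def using twist(1-3) by (auto simp del: split_paired_All energy.simps energy3.simps)
    have "finite {p \<in> mayas_at 0. energy3 p = int n}" using graded_energy3 by (simp add: graded_def)
    thus "finite (?F ((i + 1) mod 3))" by (rule rev_finite_subset) (auto simp: partial_class_def)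
  qed
  have "card (?F 0) = card (?F 1)" using le[of 0] le[of 1] le[of 2] by simp
  thus "gf (partial_class 0) energy3 $ n = gf (partial_class 1) energy3 $ n" by (simp only: gf_nth)
qed

section \<open>Diagrams made of complete blocks\<close>

lemma full_block:
  assumes "\<not> partial_at A (a div 3)" "a \<in> A" "b div 3 = a div 3"
  shows "b \<in> A"
proof -
  define k where "k = a div 3"
  have sub: "block A k \<subseteq> {3*k, 3*k+1, 3*k+2}" by (auto simp: block_def)
  have "card {3*k, 3*k+1, 3*k+2} = 3" by simp
  moreover have "card (block A k) \<le> card {3*k, 3*k+1, 3*k+2}" using sub by (intro card_mono) auto
  moreover have "card (block A k) \<noteq> 0"
    using assms(2) finite_subset[OF sub] by (auto simp: block_def k_def)
  ultimately have "card (block A k) = 3" using assms(1) by (auto simp: partial_at_def k_def)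
  hence "block A k = {3*k, 3*k+1, 3*k+2}" using sub by (intro card_subset_eq) auto
  moreover have "b \<in> {3*k, 3*k+1, 3*k+2}" using assms(3) k_def by auto
  ultimately show "b \<in> A" by (auto simp: block_def)
qed

lemma not_partial_inflate: "\<not> partial_at (interleave A A A) k"
proof -
  have "block (interleave A A A) k = (if k \<in> A then {3*k, 3*k+1, 3*k+2} else {})"
    by (auto simp: block_def interleave_def Suc_triple_div_mod)
  thus ?thesis by (simp add: partial_at_def)
qed

lemma not_partial_deflate:
  assumes "\<And>k. \<not> partial_at A k"
  shows "interleave (residue_part 0 A) (residue_part 0 A) (residue_part 0 A) = A"
proof (rule set_eqI)
  fix n
  have "3 * (n div 3) \<in> A \<longleftrightarrow> n \<in> A"
    using full_block[OF assms, of "3 * (n div 3)" n] full_block[OF assms, of n "3 * (n div 3)"] by auto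
  thus "n \<in> interleave (residue_part 0 A) (residue_part 0 A) (residue_part 0 A) \<longleftrightarrow> n \<in> A"
    by (simp add: interleave_def residue_part_def)
qed

definition inflate :: "maya \<Rightarrow> maya" where
  "inflate p = (interleave (fst p) (fst p) (fst p), interleave (snd p) (snd p) (snd p))"

lemma card_interleave:
  "finite A \<Longrightarrow> int (card (interleave A A A)) = 3 * int (card A)"
  using sum_interleave[of A A A "\<lambda>_. 1"] by simp

lemma inflate_weights:
  assumes "p \<in> mayas_at 0"
  shows "inflate p \<in> mayas_at 0" "energy3 (inflate p) = 3 * energy p" "energy (inflate p) mod 3 = 0"
proof -
  obtain A B where p: "p = (A, B)" "finite A" "finite B" "int (card A) - int (card B) = 0"
    using assms by (auto simp: mayas_at_def mayas_def)
  show "inflate p \<in> mayas_at 0"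
    using p by (simp add: inflate_def mayas_at_def mayas_def finite_interleave card_interleave)
  show "energy3 (inflate p) = 3 * energy p"
    using p by (simp add: inflate_def sum_interleave Suc_triple_div_mod)
  have "energy (inflate p) = 3 * (3 * (\<Sum>a\<in>A. int a) + 2 * int (card A) + 3 * (\<Sum>b\<in>B. int b) + int (card B))"
    unfolding p inflate_def energy.simps fst_conv snd_conv using p(2,3)
    by (simp only: sum_interleave) (simp add: sum.distrib sum_distrib_left[symmetric] sum_distrib_right[symmetric])
  thus "energy (inflate p) mod 3 = 0" by simp
qed

lemma inflate_bij: "bij_betw inflate (mayas_at 0) {p \<in> mayas_at 0. \<not> partial p}"
proof (rule bij_betw_byWitness[where f' = "\<lambda>(A, B). (residue_part 0 A, residue_part 0 B)"])
  show "\<forall>p\<in>mayas_at 0. (\<lambda>(A, B). (residue_part 0 A, residue_part 0 B)) (inflate p) = p"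
    by (simp add: inflate_def residue_part_interleave)
  show "\<forall>p\<in>{p \<in> mayas_at 0. \<not> partial p}. inflate ((\<lambda>(A, B). (residue_part 0 A, residue_part 0 B)) p) = p"
    by (auto simp: inflate_def partial_def not_partial_deflate)
  show "inflate ` mayas_at 0 \<subseteq> {p \<in> mayas_at 0. \<not> partial p}"
    using inflate_weights(1) by (auto simp: partial_def inflate_def not_partial_inflate)
  show "(\<lambda>(A, B). (residue_part 0 A, residue_part 0 B)) ` {p \<in> mayas_at 0. \<not> partial p} \<subseteq> mayas_at 0"
  proof clarify
    fix A B assume AB: "(A, B) \<in> mayas_at 0" "\<not> partial (A, B)"
    hence fin: "finite (residue_part 0 A)" "finite (residue_part 0 B)"
      by (auto simp: mayas_at_def mayas_def finite_residue_part)
    have "interleave (residue_part 0 A) (residue_part 0 A) (residue_part 0 A) = A"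
      "interleave (residue_part 0 B) (residue_part 0 B) (residue_part 0 B) = B"
      using AB by (auto simp: partial_def not_partial_deflate)
    hence "int (card A) = 3 * int (card (residue_part 0 A))" "int (card B) = 3 * int (card (residue_part 0 B))"
      using card_interleave fin by metis+
    thus "(residue_part 0 A, residue_part 0 B) \<in> mayas_at 0"
      using AB fin by (simp add: mayas_at_def mayas_def)
  qed
qed

text \<open>Compare the diagrams of energy 0 and 1 modulo 3, counted by \<open>energy3\<close>. The
  partial ones match through \<open>twist\<close>; the others are inflated diagrams, all of energy 0
  modulo 3, and contribute \<open>cube partition_gf\<close>.\<close>

lemma cubic_b_identity:
  "cube theta * partition_gf ^ 3 = cube partition_gf + 3 * fps_X * cube core_gf * partition_gf ^ 3"
proof -
  let ?C = "\<lambda>i. {p \<in> mayas_at 0. energy p mod 3 = i}"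
  let ?N = "{p \<in> mayas_at 0. \<not> partial p}"
  have gr: "graded T energy3" if "T \<subseteq> mayas_at 0" for T
    by (rule graded_subset[OF graded_energy3 that])
  have im: "inflate ` mayas_at 0 = ?N" using inflate_bij by (rule bij_betw_imp_surj_on)
  have N0: "energy p mod 3 = 0" if "p \<in> mayas_at 0" "\<not> partial p" for p
  proof -
    have "p \<in> inflate ` mayas_at 0" using that unfolding im by blast
    thus ?thesis using inflate_weights(3) by blast
  qed
  have "partial p" if "p \<in> mayas_at 0" "energy p mod 3 = 1" for p
    using N0[OF that(1)] that(2) by linarith
  hence "?C 0 = ?N \<union> partial_class 0" "?C 1 = partial_class 1"
    using N0 unfolding partial_class_def by blast+
  moreover have "gf (?N \<union> partial_class 0) energy3 = gf ?N energy3 + gf (partial_class 0) energy3"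
    by (intro gf_Un gr) (auto simp: partial_class_def)
  moreover have "gf (mayas_at 0) (\<lambda>p. 3 * energy p) = gf ?N energy3"
    by (rule gf_bij[OF inflate_bij]) (rule inflate_weights)
  ultimately have "gf (?C 0) energy3 = cube partition_gf + gf (?C 1) energy3"
    by (simp add: gf_scale partition_gf_def gf_partial_class)
  thus ?thesis
    by (simp add: frobenius_product(3) gf_residue_class_0 gf_residue_class_swap gf_residue_class_2)
qed

section \<open>Frobenius partitions as Maya diagrams\<close>

text \<open>Colors start at 1, so the truncated subtraction is exact on colored integers, and their
  order becomes the order of the naturals.\<close>

definition enc :: "nat \<times> nat \<Rightarrow> nat" where
  "enc = (\<lambda>(a, c). 3 * a + c - 1)"

definition dec :: "nat \<Rightarrow> nat \<times> nat" where
  "dec n = (n div 3, n mod 3 + 1)"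

lemma colored_nats_3: "colored_nats 3 = {(a, c). c = 1 \<or> c = 2 \<or> c = 3}"
  by (auto simp: colored_nats_def)

lemma dec_enc: "x \<in> colored_nats 3 \<Longrightarrow> dec (enc x) = x"
  by (auto simp: colored_nats_3 enc_def dec_def Suc_triple_div_mod)

lemma enc_dec: "enc (dec n) = n"
  by (simp add: enc_def dec_def)

lemma dec_colored: "dec n \<in> colored_nats 3"
  by (simp add: colored_nats_3 dec_def) presburger

lemma enc_div: "x \<in> colored_nats 3 \<Longrightarrow> enc x div 3 = fst x"
  by (auto simp: colored_nats_3 enc_def Suc_triple_div_mod)

lemma colored_less_enc:
  "x \<in> colored_nats 3 \<Longrightarrow> y \<in> colored_nats 3 \<Longrightarrow> colored_less x y \<longleftrightarrow> enc x < enc y"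
  by (auto simp: colored_nats_3 enc_def colored_less_def)

lemma frobenius_row_iff:
  "is_frobenius_row 3 xs \<longleftrightarrow> set xs \<subseteq> colored_nats 3 \<and> sorted_wrt (>) (map enc xs)"
proof -
  have "sorted_wrt (\<lambda>x y. colored_less y x) xs \<longleftrightarrow> sorted_wrt (\<lambda>x y. enc x > enc y) xs"
    if "set xs \<subseteq> colored_nats 3"
    by (rule iffI; erule sorted_wrt_mono_rel[rotated])
      (use that colored_less_enc in \<open>blast dest: subsetD\<close>)+
  thus ?thesis by (auto simp: is_frobenius_row_def sorted_wrt_map)
qed

lemma sorted_wrt_greater_iff: "sorted_wrt (>) l \<longleftrightarrow> rev (sorted_list_of_set (set l)) = (l :: nat list)"
proof
  assume "sorted_wrt (>) l"
  hence "sorted_wrt (<) (rev l)" by (simp add: sorted_wrt_rev)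
  hence "sorted (rev l)" "distinct (rev l)" by (simp_all add: strict_sorted_iff)
  thus "rev (sorted_list_of_set (set l)) = l"
    by (metis rev_swap set_rev sorted_list_of_set.idem_if_sorted_distinct)
next
  assume "rev (sorted_list_of_set (set l)) = l"
  moreover have "sorted_wrt (>) (rev (sorted_list_of_set (set l)))" by (simp add: sorted_wrt_rev)
  ultimately show "sorted_wrt (>) l" by simp
qed

definition row_of :: "nat set \<Rightarrow> (nat \<times> nat) list" where
  "row_of A = map dec (rev (sorted_list_of_set A))"

lemma row_of:
  assumes "finite A"
  shows "is_frobenius_row 3 (row_of A)" "enc ` set (row_of A) = A"
proof -
  have "map enc (row_of A) = rev (sorted_list_of_set A)"
    by (simp add: row_of_def enc_dec comp_def)
  thus "is_frobenius_row 3 (row_of A)"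
    by (auto simp: frobenius_row_iff sorted_wrt_rev row_of_def dec_colored)
  show "enc ` set (row_of A) = A" using assms by (simp add: row_of_def image_image enc_dec)
qed

lemma row_of_enc:
  assumes "is_frobenius_row 3 xs"
  shows "row_of (enc ` set xs) = xs"
proof -
  have "rev (sorted_list_of_set (set (map enc xs))) = map enc xs"
    using assms by (simp add: frobenius_row_iff sorted_wrt_greater_iff)
  hence "row_of (enc ` set xs) = map dec (map enc xs)" by (simp add: row_of_def)
  also have "\<dots> = xs" using assms by (auto simp: frobenius_row_iff dec_enc subset_iff intro!: map_idI)
  finally show ?thesis .
qed

lemma row_sums:
  assumes "is_frobenius_row 3 xs"
  shows "card (enc ` set xs) = length xs"
    "(\<Sum>a\<in>enc ` set xs. int (a div 3)) = (\<Sum>i<length xs. int (fst (xs ! i)))"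
proof -
  have row: "set xs \<subseteq> colored_nats 3" "sorted_wrt (>) (map enc xs)"
    using assms by (auto simp: frobenius_row_iff)
  hence "distinct (rev (map enc xs))"
    by (metis sorted_wrt_rev strict_sorted_iff rev_rev_ident sorted_wrt_greater_iff distinct_rev
        distinct_sorted_list_of_set)
  hence d: "distinct (map enc xs)" by simp
  show "card (enc ` set xs) = length xs" using distinct_card[OF d] by simp
  have "(\<Sum>a\<in>enc ` set xs. int (a div 3)) = (\<Sum>a\<leftarrow>map enc xs. int (a div 3))"
    using sum_list_distinct_conv_sum_set[OF d, of "\<lambda>a. int (a div 3)"] by simp
  also have "\<dots> = (\<Sum>x\<leftarrow>xs. int (fst x))"
    using row(1) by (auto simp: enc_div subset_iff intro!: arg_cong[of _ _ sum_list])
  also have "\<dots> = (\<Sum>i<length xs. int (fst (xs ! i)))"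
    by (simp add: sum_list_sum_nth atLeast0LessThan)
  finally show "(\<Sum>a\<in>enc ` set xs. int (a div 3)) = (\<Sum>i<length xs. int (fst (xs ! i)))" .
qed

text \<open>A strictly decreasing row is determined by its set of codes, and rows of equal length
  give charge 0. The summand 1 in \<open>energy3\<close> for each upper entry accounts for the
  \<open>r\<close> in the number partitioned.\<close>

lemma cphi_gf: "int (cphi 3 n) = gf (mayas_at 0) energy3 $ n"
proof -
  let ?f = "\<lambda>(as, bs). (enc ` set as, enc ` set bs)"
  have weight: "int n = energy3 (?f (as, bs)) \<longleftrightarrow>
      n = length as + (\<Sum>i<length as. fst (as ! i) + fst (bs ! i))"
    if "is_frobenius_row 3 as" "is_frobenius_row 3 bs" "length as = length bs" for as bs
  proof -
    have "energy3 (?f (as, bs)) = int (length as + (\<Sum>i<length as. fst (as ! i) + fst (bs ! i)))"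
      using row_sums[OF that(1)] row_sums[OF that(2)] that(3) by (simp add: sum.distrib)
    thus ?thesis by linarith
  qed
  have "bij_betw ?f (gen_frobenius_partitions 3 n) {p \<in> mayas_at 0. energy3 p = int n}"
  proof (rule bij_betw_byWitness[where f' = "\<lambda>(A, B). (row_of A, row_of B)"])
    show "\<forall>t\<in>gen_frobenius_partitions 3 n. (\<lambda>(A, B). (row_of A, row_of B)) (?f t) = t"
      by (auto simp: gen_frobenius_partitions_def row_of_enc)
    show "\<forall>p\<in>{p \<in> mayas_at 0. energy3 p = int n}. ?f ((\<lambda>(A, B). (row_of A, row_of B)) p) = p"
      by (auto simp: mayas_at_def mayas_def row_of)
    show "?f ` gen_frobenius_partitions 3 n \<subseteq> {p \<in> mayas_at 0. energy3 p = int n}"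
    proof clarify
      fix as bs assume "(as, bs) \<in> gen_frobenius_partitions 3 n"
      hence t: "is_frobenius_row 3 as" "is_frobenius_row 3 bs" "length as = length bs"
        "n = length as + (\<Sum>i<length as. fst (as ! i) + fst (bs ! i))"
        by (auto simp: gen_frobenius_partitions_def)
      show "(enc ` set as, enc ` set bs) \<in> mayas_at 0 \<and> energy3 (enc ` set as, enc ` set bs) = int n"
        using weight[OF t(1-3)] t(4) row_sums(1)[OF t(1)] row_sums(1)[OF t(2)] t(3)
        by (simp add: mayas_at_def mayas_def del: energy3.simps)
    qed
    show "(\<lambda>(A, B). (row_of A, row_of B)) ` {p \<in> mayas_at 0. energy3 p = int n} \<subseteq> gen_frobenius_partitions 3 n"
    proof clarify
      fix A B assume AB: "(A, B) \<in> mayas_at 0" "energy3 (A, B) = int n"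
      hence fin: "finite A" "finite B" "card A = card B" by (auto simp: mayas_at_def mayas_def)
      note rows = row_of[OF fin(1)] row_of[OF fin(2)]
      have len: "length (row_of A) = length (row_of B)" by (simp add: row_of_def fin(3))
      show "(row_of A, row_of B) \<in> gen_frobenius_partitions 3 n"
        unfolding gen_frobenius_partitions_def
        using weight[OF rows(1) rows(3) len] rows len AB(2) by (simp del: energy3.simps)
    qed
  qed
  from bij_betw_same_card[OF this] show ?thesis
    unfolding cphi_def gf_nth by (rule arg_cong)
qed

lemma cphi_generating_function: "int (cphi 3 n) = (theta * partition_gf ^ 3) $ n"
  by (simp add: cphi_gf frobenius_product(1))

section \<open>The cubic theta identities\<close>

text \<open>This is the product of all 1 - q^n, obtained here as the inverse of the partition
  series.\<close>

definition euler :: "int fps" where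
  "euler = fps_right_inverse partition_gf 1"

definition theta_inv :: "int fps" where
  "theta_inv = fps_right_inverse (cube theta) 1"

lemma partition_gf_0: "partition_gf $ 0 = 1"
proof -
  have "{p \<in> mayas_at 0. energy p = int 0} = {({}, {})}"
  proof
    show "{p \<in> mayas_at 0. energy p = int 0} \<subseteq> {({}, {})}"
    proof clarify
      fix A B assume AB: "(A, B) \<in> mayas_at 0" "energy (A, B) = int 0"
      hence fin: "finite A" "finite B" "card A = card B" by (auto simp: mayas_at_def mayas_def)
      have "(\<Sum>a\<in>A. int a) + int (card A) + (\<Sum>b\<in>B. int b) = 0"
        using AB(2) by (simp add: sum.distrib)
      moreover have "0 \<le> (\<Sum>a\<in>A. int a)" "0 \<le> (\<Sum>b\<in>B. int b)" by (simp_all add: sum_nonneg)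
      ultimately have "card A = 0" by linarith
      thus "A = {} \<and> B = {}" using fin by simp
    qed
  qed (auto simp: mayas_at_def mayas_def)
  thus ?thesis by (simp add: partition_gf_def gf_nth)
qed

lemma theta_0: "theta $ 0 = 1"
proof -
  have "{t \<in> UNIV. eis t = int 0} = {(0, 0)}"
  proof
    show "{t \<in> UNIV. eis t = int 0} \<subseteq> {(0, 0)}"
    proof clarify
      fix x y assume "eis (x, y) = int 0"
      moreover have "2 * eis (x, y) = x\<^sup>2 + y\<^sup>2 + (x + y)\<^sup>2"
        by (simp add: eis_def power2_eq_square algebra_simps)
      ultimately have "x\<^sup>2 + y\<^sup>2 \<le> 0" using zero_le_power2[of "x + y"] by linarith
      thus "x = 0 \<and> y = 0" by (simp only: sum_power2_le_zero_iff)
    qed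
  qed (auto simp: eis_def)
  thus ?thesis unfolding theta_def gf_nth by simp
qed

lemma partition_euler: "partition_gf * euler = 1"
  unfolding euler_def by (rule fps_right_inverse) (simp add: partition_gf_0)

lemma theta_inverse: "cube theta * theta_inv = 1"
  unfolding theta_inv_def by (rule fps_right_inverse) (simp add: cube_nth theta_0)

lemma partition_euler_powers [simp]:
  "partition_gf ^ n * euler ^ n = 1" "cube partition_gf ^ n * cube euler ^ n = 1"
  by (simp_all add: power_mult_distrib[symmetric] partition_euler cube_mult[symmetric])

text \<open>The cubic theta functions are \<open>a(q) = theta\<close>, \<open>b(q) = cubic_b\<close> and
  \<open>c(q\<^sup>3) = cubic_c\<close>.\<close>

definition cubic_b :: "int fps" where
  "cubic_b = euler ^ 3 * cube partition_gf"

definition cubic_c :: "int fps" where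
  "cubic_c = 3 * fps_X * cube core_gf"

lemma theta_eq: "theta = cube theta + 2 * cubic_c"
  using theta_dissection by (simp add: cubic_c_def mult.assoc)

lemma core_gf_eq: "core_gf = partition_gf * cube euler ^ 3"
proof -
  have "partition_gf * cube euler ^ 3 = core_gf * (cube partition_gf ^ 3 * cube euler ^ 3)"
    using frobenius_product(2) by (metis mult.assoc)
  thus ?thesis by simp
qed

lemma cubic_b_eq: "cubic_b = cube theta - cubic_c"
proof -
  have "cube theta * (partition_gf ^ 3 * euler ^ 3) =
      euler ^ 3 * cube partition_gf + cubic_c * (partition_gf ^ 3 * euler ^ 3)"
    using arg_cong[OF cubic_b_identity, of "\<lambda>f. f * euler ^ 3"]
    by (simp add: cubic_c_def algebra_simps)
  thus ?thesis by (simp add: cubic_b_def)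
qed

text \<open>Coefficient \<open>n\<close> of the right-hand side involves \<open>f\<close> only at
  indices up to \<open>(n - 1) div 3\<close>, which lie below \<open>n\<close>, so strong induction
  applies.\<close>

lemma fixed_point_zero:
  assumes eq: "b * f = fps_X * g * cube f" and b: "b $ 0 = 1"
  shows "f = 0"
proof (rule fps_ext)
  fix n
  show "f $ n = 0 $ n"
  proof (induction n rule: less_induct)
    case (less n)
    have "(b * f) $ n = b $ 0 * f $ n + (\<Sum>i\<in>{1..n}. b $ i * f $ (n - i))"
      by (simp add: fps_mult_nth sum.atLeast_Suc_atMost)
    also have "(\<Sum>i\<in>{1..n}. b $ i * f $ (n - i)) = 0"
      by (rule sum.neutral) (use less in auto)
    finally have "f $ n = (fps_X * (g * cube f)) $ n"
      using b eq by (simp add: mult.assoc)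
    also have "\<dots> = 0"
    proof (cases n)
      case (Suc m)
      have "g $ i * cube f $ (m - i) = 0" for i
        using less[of "(m - i) div 3"] Suc by (simp add: cube_nth)
      hence "(g * cube f) $ m = 0" unfolding fps_mult_nth by (intro sum.neutral ballI)
      thus ?thesis using Suc by simp
    qed simp
    finally show ?case by simp
  qed
qed

text \<open>The defect of the cubic identity satisfies \<open>b(q) f(q) = 9 c(q\<^sup>3) f(q\<^sup>3)\<close>, which forces
  \<open>f = 0\<close> by comparing orders of vanishing.\<close>

lemma cubic_identity: "theta ^ 3 = cubic_b ^ 3 + 27 * fps_X * core_gf ^ 3"
proof -
  define f where "f = theta ^ 3 - cubic_b ^ 3 - 27 * fps_X * core_gf ^ 3"
  have cube_f: "cube f = cube theta ^ 3 - cube cubic_b ^ 3 - cubic_c ^ 3"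
    by (simp add: f_def cubic_c_def cube_diff cube_mult cube_power cube_X power_mult_distrib)
  \<comment> \<open>Expanded in \<open>partition_gf\<close> and \<open>euler\<close>, both sides
    reduce to \<open>27 * fps_X * cube euler ^ 9 * cube partition_gf\<close>.\<close>
  have key: "27 * fps_X * core_gf ^ 3 * cubic_b = 9 * cube cubic_b ^ 3 * cubic_c"
  proof -
    have "27 * fps_X * core_gf ^ 3 * cubic_b =
        27 * fps_X * (partition_gf ^ 3 * euler ^ 3) * cube euler ^ 9 * cube partition_gf"
      by (simp add: core_gf_eq cubic_b_def power_mult_distrib flip: power_mult)
    moreover have "9 * cube cubic_b ^ 3 * cubic_c = 27 * fps_X * cube euler ^ 9 * cube partition_gf *
        (cube (cube partition_gf) ^ 3 * cube (cube euler) ^ 3)"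
      by (simp add: core_gf_eq cubic_b_def cubic_c_def power_mult_distrib cube_mult cube_power flip: power_mult)
    moreover have "cube (cube partition_gf) ^ 3 * cube (cube euler) ^ 3 = 1"
      by (simp add: partition_euler cube_mult[symmetric] power_mult_distrib[symmetric])
    ultimately show ?thesis by simp
  qed
  \<comment> \<open>With a = z + 2y and b = z - y, the difference a^3 - b^3 is 9y(z^2 + zy + y^2),
    and multiplication by b turns it into 9y(z^3 - y^3); \<open>key\<close> supplies the remaining
    term.\<close>
  have "cubic_b * f = 9 * cubic_c * cube f"
    unfolding cube_f unfolding f_def using key cubic_b_eq theta_eq by algebra
  hence "cubic_b * f = fps_X * (27 * cube core_gf) * cube f"
    by (simp add: cubic_c_def mult_ac)
  moreover have "euler $ 0 = 1"
    using arg_cong[OF partition_euler, of "\<lambda>f. f $ 0"] by (simp add: partition_gf_0)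
  hence "cubic_b $ 0 = 1" by (simp add: cubic_b_def cube_nth partition_gf_0 fps_power_zeroth)
  ultimately have "f = 0" by (rule fixed_point_zero)
  thus ?thesis by (simp add: f_def algebra_simps)
qed

section \<open>Dissection of the cube of the partition series\<close>

definition cubic_q :: "int fps" where
  "cubic_q = cube theta ^ 2 + cube theta * cubic_c + cubic_c ^ 2"

text \<open>This is \<open>partition_gf\<close> divided by \<open>cubic_b ^ 3\<close>, written
  without division.\<close>

definition cubic_r :: "int fps" where
  "cubic_r = partition_gf ^ 10 * cube euler ^ 3"

definition cubic_x :: "int fps" where
  "cubic_x = 27 * fps_X * core_gf ^ 3"

lemma cubic_x_eq: "cubic_x = 9 * cubic_c * cubic_q"
  using cubic_identity theta_eq cubic_b_eq unfolding cubic_x_def cubic_q_def by algebra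

lemma cubic_c_power3: "cubic_c ^ 3 = cube cubic_x"
  by (simp add: cubic_c_def cubic_x_def cube_mult cube_power cube_X power_mult_distrib)

text \<open>Since z - y = b(q), the product of \<open>cubic_b\<close> and \<open>cubic_q\<close> is
  z^3 - y^3, which is b(q^3)^3 by the cubic identity at q^3. Thus P(q)^3 = P(q^3)/b(q) is
  \<open>cubic_q\<close> times P(q^3)/b(q^3)^3.\<close>

lemma partition_dissection: "partition_gf ^ 3 = cubic_q * cube cubic_r"
proof -
  have b: "cubic_b * cubic_q = cube cubic_b ^ 3"
  proof -
    have "cube theta ^ 3 = cube cubic_b ^ 3 + cubic_c ^ 3"
      using arg_cong[OF cubic_identity, of cube]
      by (simp add: cubic_c_def cube_add cube_mult cube_power cube_X power_mult_distrib)
    thus ?thesis using cubic_b_eq unfolding cubic_q_def by algebra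
  qed
  \<comment> \<open>\<open>t\<close> is the inverse of \<open>cube cubic_b ^ 3\<close>.\<close>
  define t where "t = cube partition_gf ^ 9 * cube (cube euler) ^ 3"
  have "partition_gf ^ 3 * (cubic_b * cubic_q) =
      (partition_gf ^ 3 * euler ^ 3) * (cube partition_gf * cubic_q)"
    by (simp add: cubic_b_def mult_ac del: partition_euler_powers)
  hence 1: "partition_gf ^ 3 * cube cubic_b ^ 3 = cube partition_gf * cubic_q"
    unfolding b by simp
  have "cube cubic_b ^ 3 * t = (cube partition_gf ^ 9 * cube euler ^ 9) *
      (cube (cube partition_gf) ^ 3 * cube (cube euler) ^ 3)"
    by (simp add: t_def cubic_b_def power_mult_distrib cube_mult cube_power mult_ac
        del: partition_euler_powers flip: power_mult)
  also have "cube (cube partition_gf) ^ 3 * cube (cube euler) ^ 3 = 1"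
    by (simp add: partition_euler cube_mult[symmetric] power_mult_distrib[symmetric])
  finally have 2: "cube cubic_b ^ 3 * t = 1" by simp
  have 3: "cube cubic_r = cube partition_gf * t"
    by (simp add: t_def cubic_r_def cube_mult cube_power eval_nat_numeral mult_ac)
  have "partition_gf ^ 3 = partition_gf ^ 3 * cube cubic_b ^ 3 * t"
    by (simp add: 2 mult.assoc)
  also have "\<dots> = cubic_q * cube cubic_r"
    unfolding 1 3 by (simp only: mult_ac)
  finally show ?thesis .
qed

section \<open>Iterated trisection\<close>

text \<open>Forms of degree \<open>d\<close> in \<open>z\<close> and \<open>y\<close> are represented as \<open>z\<^sup>d p(y/z)\<close>.\<close>

definition ev :: "int poly \<Rightarrow> int fps" where
  "ev p = poly (map_poly of_int p) (cubic_c * theta_inv)"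

lemma ev_0 [simp]: "ev 0 = 0"
  by (simp add: ev_def)

lemma ev_pCons [simp]: "ev (pCons c p) = of_int c + cubic_c * theta_inv * ev p"
  by (simp add: ev_def map_poly_pCons)

lemma ev_add: "ev (p + q) = ev p + ev q"
  by (induction p q rule: poly_induct2) (simp_all add: algebra_simps)

lemma ev_smult: "ev (smult c p) = of_int c * ev p"
  by (induction p) (simp_all add: algebra_simps)

lemma ev_mult: "ev (p * q) = ev p * ev q"
  by (induction p) (simp_all add: ev_add ev_smult algebra_simps)

lemma ev_power: "ev (p ^ n) = ev p ^ n"
  by (induction n) (simp_all add: ev_mult one_pCons)

lemma ev_sum: "ev (sum p S) = (\<Sum>s\<in>S. ev (p s))"
  by (induction S rule: infinite_finite_induct) (simp_all add: ev_add)

definition poly_a :: "int poly" where "poly_a = [:1, 2:]"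
definition poly_q :: "int poly" where "poly_q = [:1, 1, 1:]"

lemma cubic_c_ev: "cube theta * ev [:0, 1:] = cubic_c"
proof -
  have "cube theta * ev [:0, 1:] = cubic_c * (cube theta * theta_inv)" by simp
  thus ?thesis by (simp only: theta_inverse mult_1_right)
qed

lemma theta_ev: "theta = cube theta * ev poly_a"
proof -
  have "ev poly_a = 1 + 2 * ev [:0, 1:]" by (simp add: poly_a_def)
  thus ?thesis using theta_eq cubic_c_ev by (metis distrib_left mult.left_commute mult_1_right)
qed

lemma cubic_q_ev: "cubic_q = cube theta ^ 2 * ev poly_q"
proof -
  have "ev poly_q = 1 + ev [:0, 1:] + ev [:0, 1:] ^ 2"
    by (simp add: poly_q_def power2_eq_square algebra_simps)
  hence "cube theta ^ 2 * ev poly_q = cube theta ^ 2 + cube theta * (cube theta * ev [:0, 1:]) + (cube theta * ev [:0, 1:]) ^ 2"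
    by (simp only: power2_eq_square) (simp only: algebra_simps mult_1_right mult_1_left)
  thus ?thesis by (simp only: cubic_c_ev cubic_q_def)
qed

definition poly_x :: "int poly" where "poly_x = [:0, 1:] * poly_q"

lemma cubic_x_ev: "cubic_x = cube theta ^ 3 * (9 * ev poly_x)"
  unfolding cubic_x_eq cubic_q_ev poly_x_def ev_mult cubic_c_ev[symmetric]
  by (simp add: power2_eq_square power3_eq_cube mult_ac del: ev_pCons)

section \<open>Extraction from homogeneous forms\<close>

lemma ev_expand:
  assumes "degree p \<le> d"
  shows "cube theta ^ d * ev p = (\<Sum>s\<le>d. of_int (coeff p s) * cube theta ^ (d - s) * cubic_c ^ s)"
proof -
  have "p = (\<Sum>s\<le>d. monom (coeff p s) s)" using poly_as_sum_of_monoms'[OF assms] by simp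
  hence "ev p = (\<Sum>s\<le>d. ev (monom (coeff p s) s))" using ev_sum by metis
  also have "cube theta ^ d * \<dots> = (\<Sum>s\<le>d. of_int (coeff p s) * cube theta ^ (d - s) * cubic_c ^ s)"
    unfolding sum_distrib_left
  proof (rule sum.cong[OF refl])
    fix s assume "s \<in> {..d}"
    hence "cube theta ^ d = cube theta ^ (d - s) * cube theta ^ s" by (simp flip: power_add)
    moreover have "ev (monom (coeff p s) s) = of_int (coeff p s) * ev [:0, 1:] ^ s"
      by (simp add: monom_altdef ev_smult ev_power)
    moreover have "cube theta ^ s * ev [:0, 1:] ^ s = cubic_c ^ s"
      unfolding power_mult_distrib[symmetric] cubic_c_ev ..
    ultimately show "cube theta ^ d * ev (monom (coeff p s) s) =
        of_int (coeff p s) * cube theta ^ (d - s) * cubic_c ^ s"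
      by (metis (no_types, lifting) mult.assoc mult.left_commute)
  qed
  finally show ?thesis .
qed

text \<open>\<open>cubic_c\<close> is 3q times a series in q^3, so its power \<open>s\<close> lives
  in the residue of \<open>s\<close>. Whole triples of factors become \<open>cubic_x\<close>, and
  the remaining ones yield \<open>3 ^ r\<close>.\<close>

lemma sect_cubic_c_power:
  assumes "r < 3"
  shows "sect r (cubic_c ^ s) = (if s mod 3 = r then 3 ^ r * core_gf ^ r * cubic_x ^ (s div 3) else 0)"
proof -
  define k where "k = s mod 3"
  have k: "k < 3" by (simp add: k_def)
  have "cubic_c ^ s = (cubic_c ^ 3) ^ (s div 3) * cubic_c ^ k"
    unfolding k_def by (simp flip: power_mult power_add)
  also have "\<dots> = cube (cubic_x ^ (s div 3) * (3 ^ k * core_gf ^ k)) * fps_X ^ k"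
    unfolding cubic_c_power3
    by (simp add: cube_mult cube_power cubic_c_def power_mult_distrib mult_ac)
  finally have "sect r (cubic_c ^ s) = cubic_x ^ (s div 3) * (3 ^ k * core_gf ^ k) * sect r (fps_X ^ k)"
    using sect_cube_mult[OF assms] by simp
  thus ?thesis
    unfolding sect_X_power[OF assms k] by (auto simp: k_def mult_ac)
qed

text \<open>Extraction turns z into \<open>theta\<close> and y^3 into \<open>cubic_x\<close>; these
  are again z times \<open>poly_a\<close> and 9z^3 times \<open>poly_x\<close>, evaluated at y/z.
  Each term has degree \<open>d - s + 3 * (s div 3) = d - r\<close>.\<close>

definition step_poly :: "nat \<Rightarrow> nat \<Rightarrow> int poly \<Rightarrow> int poly" where
  "step_poly r d p = (\<Sum>s | s \<le> d \<and> s mod 3 = r.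
     smult (coeff p s * 9 ^ (s div 3)) (poly_a ^ (d - s) * poly_x ^ (s div 3)))"

definition step_quot :: "int \<Rightarrow> nat \<Rightarrow> nat \<Rightarrow> int poly \<Rightarrow> int poly" where
  "step_quot m r d p = (\<Sum>s | s \<le> d \<and> s mod 3 = r.
     smult (coeff p s * 9 ^ (s div 3) div m) (poly_a ^ (d - s) * poly_x ^ (s div 3)))"

lemma smult_sum_right: "smult c (sum f S) = (\<Sum>s\<in>S. smult c (f s))"
  by (induction S rule: infinite_finite_induct) (simp_all add: smult_add_right)

lemma step_poly_quot:
  assumes "\<And>s. s \<le> d \<Longrightarrow> s mod 3 = r \<Longrightarrow> m dvd coeff p s * 9 ^ (s div 3)"
  shows "step_poly r d p = smult m (step_quot m r d p)"
  unfolding step_poly_def step_quot_def smult_sum_right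
  by (rule sum.cong) (use assms in auto)

lemma degree_step_quot:
  assumes "r < 3"
  shows "degree (step_quot m r d p) \<le> d - r"
  unfolding step_quot_def
proof (rule degree_sum_le)
  fix s assume s: "s \<in> {s. s \<le> d \<and> s mod 3 = r}"
  have "degree (poly_a ^ (d - s)) \<le> d - s"
    using degree_power_le[of poly_a "d - s"] by (simp add: poly_a_def)
  moreover have "degree (poly_x ^ (s div 3)) \<le> 3 * (s div 3)"
    using degree_power_le[of poly_x "s div 3"] by (simp add: poly_x_def poly_q_def)
  moreover have "3 * (s div 3) + r = s" "s \<le> d" using s by auto
  ultimately show "degree (smult (coeff p s * 9 ^ (s div 3) div m) (poly_a ^ (d - s) * poly_x ^ (s div 3))) \<le> d - r"
    using degree_mult_le[of "poly_a ^ (d - s)" "poly_x ^ (s div 3)"]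
    by (intro order_trans[OF degree_smult_le]) linarith
qed simp

lemma sect_ev:
  assumes "r < 3" "degree p \<le> d"
  shows "sect r (cube w * (cube theta ^ d * ev p)) =
    3 ^ r * (w * core_gf ^ r * (cube theta ^ (d - r) * ev (step_poly r d p)))"
proof -
  have "sect r (cube w * (cube theta ^ d * ev p)) =
      w * (\<Sum>s\<le>d. of_int (coeff p s) * theta ^ (d - s) * sect r (cubic_c ^ s))"
    unfolding ev_expand[OF assms(2)]
    by (simp only: sect_cube_mult[OF assms(1)] sect_sum mult.assoc sect_of_int_mult cube_power[symmetric])
  also have "(\<Sum>s\<le>d. of_int (coeff p s) * theta ^ (d - s) * sect r (cubic_c ^ s)) =
      (\<Sum>s | s \<le> d \<and> s mod 3 = r. of_int (coeff p s) * theta ^ (d - s) * (3 ^ r * core_gf ^ r * cubic_x ^ (s div 3)))"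
    by (rule sum.mono_neutral_cong_right) (auto simp: sect_cubic_c_power[OF assms(1)])
  also have "\<dots> = (\<Sum>s | s \<le> d \<and> s mod 3 = r. 3 ^ r * core_gf ^ r * (cube theta ^ (d - r) *
      ev (smult (coeff p s * 9 ^ (s div 3)) (poly_a ^ (d - s) * poly_x ^ (s div 3)))))"
  proof (rule sum.cong[OF refl])
    fix s assume s: "s \<in> {s. s \<le> d \<and> s mod 3 = r}"
    hence "3 * (s div 3) + r = s" by auto
    hence e: "d - r = (d - s) + 3 * (s div 3)" using s by auto
    have "theta ^ (d - s) * cubic_x ^ (s div 3) =
        (cube theta ^ (d - s) * cube theta ^ (3 * (s div 3))) * (9 ^ (s div 3) * (ev poly_a ^ (d - s) * ev poly_x ^ (s div 3)))"
      by (subst theta_ev, subst cubic_x_ev) (simp add: power_mult_distrib power_mult mult_ac)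
    also have "\<dots> = cube theta ^ (d - r) * (9 ^ (s div 3) * (ev poly_a ^ (d - s) * ev poly_x ^ (s div 3)))"
      by (simp only: e power_add)
    finally show "of_int (coeff p s) * theta ^ (d - s) * (3 ^ r * core_gf ^ r * cubic_x ^ (s div 3)) =
      3 ^ r * core_gf ^ r * (cube theta ^ (d - r) *
      ev (smult (coeff p s * 9 ^ (s div 3)) (poly_a ^ (d - s) * poly_x ^ (s div 3))))"
      by (simp add: ev_smult ev_mult ev_power mult_ac)
  qed
  also have "\<dots> = 3 ^ r * core_gf ^ r * (cube theta ^ (d - r) * ev (step_poly r d p))"
    by (simp add: step_poly_def ev_sum sum_distrib_left)
  finally show ?thesis by (simp add: mult_ac)
qed

text \<open>The shape kept by every extraction: a product of powers in q^3 times a form of degree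
  \<open>d\<close> in z and y.\<close>

definition form :: "nat \<Rightarrow> nat \<Rightarrow> nat \<Rightarrow> int poly \<Rightarrow> int fps" where
  "form i j d p = cube (euler ^ i * cubic_r ^ j) * (cube theta ^ d * ev p)"

text \<open>The third premise makes the power of the partition series a multiple of 3, so that it can be
  dissected again.\<close>

lemma form_step:
  assumes "r < 3" "degree p \<le> d" "r + 10 * j = i + 3 * k"
    and "\<And>s. s \<le> d \<Longrightarrow> s mod 3 = r \<Longrightarrow> m dvd coeff p s * 9 ^ (s div 3)"
  shows "sect r (form i j d p) = of_int (3 ^ r * m) *
    form (3 * j + 3 * r) k (2 * k + (d - r)) (poly_q ^ k * step_quot m r d p)"
proof -
  \<comment> \<open>In q, the factors contain \<open>partition_gf\<close> to the power
    \<open>r + 10 * j\<close>. Of these, \<open>i\<close> cancel against \<open>euler ^ i\<close>,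
    and the other \<open>3 * k\<close> are replaced by means of \<open>partition_dissection\<close>,
    which adds \<open>2 * k\<close> to the degree.\<close>
  have "euler ^ i * cubic_r ^ j * core_gf ^ r =
      euler ^ i * partition_gf ^ (r + 10 * j) * (cube euler ^ (3 * j) * cube euler ^ (3 * r))"
    unfolding core_gf_eq cubic_r_def
    by (simp add: power_mult_distrib power_add mult_ac flip: power_mult)
  also have "\<dots> = (partition_gf ^ i * euler ^ i) * (partition_gf ^ 3) ^ k * cube (euler ^ (3 * j + 3 * r))"
    unfolding assms(3)
    by (simp add: power_add cube_mult cube_power mult_ac del: partition_euler_powers flip: power_mult)
  also have "\<dots> = cube (euler ^ (3 * j + 3 * r) * cubic_r ^ k) * (cube theta ^ (2 * k) * ev (poly_q ^ k))"
    unfolding partition_dissection cubic_q_ev partition_euler_powers ev_power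
    by (simp add: cube_mult cube_power power_mult_distrib mult_ac del: partition_euler_powers flip: power_mult)
  finally have w: "euler ^ i * cubic_r ^ j * core_gf ^ r =
    cube (euler ^ (3 * j + 3 * r) * cubic_r ^ k) * (cube theta ^ (2 * k) * ev (poly_q ^ k))" .
  have quot: "step_poly r d p = smult m (step_quot m r d p)"
    by (rule step_poly_quot) (fact assms(4))
  show ?thesis
    unfolding form_def sect_ev[OF assms(1,2)] w quot
    by (simp add: ev_smult ev_mult power_add mult_ac)
qed

lemma form_sect_dvd:
  assumes "r < 3" "degree p \<le> d"
    and "\<And>s. s \<le> d \<Longrightarrow> s mod 3 = r \<Longrightarrow> m dvd coeff p s * 9 ^ (s div 3)"
  shows "3 ^ r * m dvd sect r (form i j d p) $ n"
proof -
  have quot: "step_poly r d p = smult m (step_quot m r d p)"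
    by (rule step_poly_quot) (fact assms(3))
  have "sect r (form i j d p) = of_int (3 ^ r * m) *
      (euler ^ i * cubic_r ^ j * core_gf ^ r * (cube theta ^ (d - r) * ev (step_quot m r d p)))"
    unfolding form_def sect_ev[OF assms(1,2)] quot
    by (simp add: ev_smult mult_ac)
  thus ?thesis by (simp flip: fps_of_int)
qed

lemma degree_step:
  assumes "r < 3"
  shows "degree (poly_q ^ k * step_quot m r d p) \<le> 2 * k + (d - r)"
proof -
  have "degree (poly_q ^ k) \<le> 2 * k" using degree_power_le[of poly_q k] by (simp add: poly_q_def)
  thus ?thesis
    using degree_step_quot[OF assms, of m d p] degree_mult_le[of "poly_q ^ k" "step_quot m r d p"] by linarith
qed

section \<open>The lowest coefficients of the polynomials\<close>

lemma coeff_mult_low: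
  "coeff (p * q) 0 = coeff p 0 * coeff q 0"
  "coeff (p * q) 1 = coeff p 0 * coeff q 1 + coeff p 1 * coeff q 0"
  "coeff (p * q) 2 = coeff p 0 * coeff q 2 + coeff p 1 * coeff q 1 + coeff p 2 * coeff q 0"
  by (simp_all add: coeff_mult numeral_2_eq_2)

lemma coeff_power_low:
  fixes p :: "int poly"
  assumes "coeff p 0 = 1"
  shows "coeff (p ^ n) 0 = 1" "coeff (p ^ n) 1 = int n * coeff p 1"
    "2 * coeff (p ^ n) 2 = 2 * int n * coeff p 2 + int n * (int n - 1) * (coeff p 1)\<^sup>2"
proof (induction n)
  case (Suc n)
  {
    case 1 show ?case using Suc assms by (simp add: coeff_mult_low)
  next
    case 2 show ?case using Suc assms by (simp add: coeff_mult_low(2)[unfolded One_nat_def] algebra_simps)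
  next
    case 3 show ?case using Suc assms
      by (simp add: coeff_mult_low(3) algebra_simps power2_eq_square)
  }
qed simp_all

lemma coeff_q_a_low:
  fixes m n :: nat
  shows "coeff (poly_q ^ m * poly_a ^ n) 0 = 1"
    "coeff (poly_q ^ m * poly_a ^ n) 1 = int m + 2 * int n"
    "2 * coeff (poly_q ^ m * poly_a ^ n) 2 =
      int m * (int m + 1) + 4 * int m * int n + 4 * (int n * (int n - 1))"
proof -
  have q: "coeff poly_q 0 = 1" "coeff poly_q 1 = 1" "coeff poly_q 2 = 1"
    and a: "coeff poly_a 0 = 1" "coeff poly_a 1 = 2" "coeff poly_a 2 = 0"
    by (simp_all add: poly_q_def poly_a_def numeral_2_eq_2)
  note ql = coeff_power_low[OF q(1), of m] and al = coeff_power_low[OF a(1), of n]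
  show "coeff (poly_q ^ m * poly_a ^ n) 0 = 1" using ql al by (simp add: coeff_mult_low)
  show "coeff (poly_q ^ m * poly_a ^ n) 1 = int m + 2 * int n"
    unfolding coeff_mult_low(2) using ql al q a by simp
  show "2 * coeff (poly_q ^ m * poly_a ^ n) 2 =
      int m * (int m + 1) + 4 * int m * int n + 4 * (int n * (int n - 1))"
    unfolding coeff_mult_low(3) using ql al q a by (simp add: algebra_simps)
qed

text \<open>Terms with \<open>s \<ge> 3\<close> carry a factor 9, so for \<open>m = 3\<close> or
  \<open>m = 9\<close> only the coefficient of index \<open>r\<close> has to be inspected.\<close>

lemma dvd_by_residue:
  fixes p :: "int poly"
  assumes "r < 3" "s mod 3 = r" "m dvd coeff p r" "m dvd coeff p s * 9"
  shows "m dvd coeff p s * 9 ^ (s div 3)"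
proof (cases "s < 3")
  case True
  thus ?thesis using assms by simp
next
  case False
  then obtain k where "s div 3 = Suc k"
    by (metis div_greater_zero_iff gr0_conv_Suc not_less zero_less_numeral)
  hence "coeff p s * 9 ^ (s div 3) = coeff p s * 9 * 9 ^ k" by (simp only: power_Suc mult.assoc)
  thus ?thesis using assms(4) by (simp only: dvd_mult2)
qed

lemma sect_of_int_mult_dvd:
  assumes "c dvd sect r f $ n" "e = d * c"
  shows "e dvd sect r (of_int d * f) $ n"
  using assms by (simp add: sect_of_int_mult flip: fps_of_int)

section \<open>The chain of extractions and its powers of 3\<close>

definition frobenius_gf :: "int fps" where
  "frobenius_gf = theta * partition_gf ^ 3"

lemma frobenius_gf_form: "frobenius_gf = form 0 1 3 (poly_q * poly_a)"
proof -
  have "frobenius_gf = cube cubic_r * (cubic_q * theta)"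
    by (simp add: frobenius_gf_def partition_dissection mult_ac)
  also have "\<dots> = cube cubic_r * (cube theta ^ 3 * (ev poly_q * ev poly_a))"
    by (subst theta_ev, subst cubic_q_ev) (simp add: power2_eq_square power3_eq_cube mult_ac)
  finally show ?thesis by (simp add: form_def ev_mult)
qed

lemma coeff_poly_qa: "poly_q * poly_a = [:1, 3, 3, 2:]"
  by (simp add: poly_q_def poly_a_def)

lemma frobenius_gf_sect_1: "3 ^ 2 dvd sect 1 frobenius_gf $ n"
proof -
  have "3 dvd coeff (poly_q * poly_a) s * 9 ^ (s div 3)" if "s mod 3 = 1" for s
    by (rule dvd_by_residue[OF _ that]) (simp_all add: coeff_poly_qa)
  thus ?thesis unfolding frobenius_gf_form
    using form_sect_dvd[of 1 "poly_q * poly_a" 3 3 0 1 n] by (simp add: coeff_poly_qa)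
qed

lemma frobenius_gf_sect_2:
  "sect 2 frobenius_gf = of_int (3 ^ 3) * form 9 4 9 (poly_q ^ 4 * poly_a)"
proof -
  have d: "3 dvd coeff (poly_q * poly_a) s * 9 ^ (s div 3)" if "s mod 3 = 2" for s
    by (rule dvd_by_residue[OF _ that]) (simp_all add: coeff_poly_qa numeral_2_eq_2)
  \<comment> \<open>Only the y^2 term of the cubic form has index 2 modulo 3; its coefficient 3 is
    divided out and the linear factor \<open>poly_a\<close> is left.\<close>
  have "{s. s \<le> 3 \<and> s mod 3 = (2 :: nat)} = {2}" by auto presburger
  hence "step_quot 3 2 3 (poly_q * poly_a) = poly_a"
    by (simp add: step_quot_def coeff_poly_qa numeral_2_eq_2)
  thus ?thesis
    unfolding frobenius_gf_form
    using form_step[of 2 "poly_q * poly_a" 3 1 0 4 3] d by (simp add: coeff_poly_qa)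
qed

lemma second_sections:
  defines "p \<equiv> step_quot 9 2 9 (poly_q ^ 4 * poly_a)"
  shows "3 ^ 5 dvd sect 1 (sect 2 frobenius_gf) $ n"
    and "sect 2 (sect 2 frobenius_gf) = of_int (3 ^ 7) * form 18 11 29 (poly_q ^ 11 * p)"
proof -
  let ?p = "poly_q ^ 4 * poly_a"
  have low: "coeff ?p 1 = 6" "coeff ?p 2 = 18"
    using coeff_q_a_low(2,3)[of 4 1] by simp_all
  have deg: "degree ?p \<le> 9"
    using degree_mult_le[of "poly_q ^ 4" poly_a] degree_power_le[of poly_q 4]
    by (simp add: poly_q_def poly_a_def)
  have "3 dvd coeff ?p s * 9 ^ (s div 3)" if "s mod 3 = 1" for s
    by (rule dvd_by_residue[OF _ that]) (use low in \<open>simp_all\<close>)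
  hence "3 ^ 1 * 3 dvd sect 1 (form 9 4 9 ?p) $ n"
    by (intro form_sect_dvd deg) auto
  thus "3 ^ 5 dvd sect 1 (sect 2 frobenius_gf) $ n"
    unfolding frobenius_gf_sect_2 by (rule sect_of_int_mult_dvd) simp
  have "9 dvd coeff ?p s * 9 ^ (s div 3)" if "s mod 3 = 2" for s
    by (rule dvd_by_residue[OF _ that]) (use low in \<open>simp_all\<close>)
  hence "sect 2 (form 9 4 9 ?p) = of_int (3 ^ 2 * 9) *
      form (3 * 4 + 3 * 2) 11 (2 * 11 + (9 - 2)) (poly_q ^ 11 * p)"
    unfolding p_def by (intro form_step deg) auto
  thus "sect 2 (sect 2 frobenius_gf) = of_int (3 ^ 7) * form 18 11 29 (poly_q ^ 11 * p)"
    unfolding frobenius_gf_sect_2 sect_of_int_mult by simp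
qed

text \<open>All terms beyond \<open>s = r\<close> contain a factor 9, so modulo 9 the new polynomial
  is known up to the scalar \<open>coeff p r\<close>.\<close>

lemma step_quot_1_mod_9:
  assumes "r < 3" "r \<le> d"
  shows "\<exists>m. step_quot 1 r d p = smult (coeff p r) (poly_a ^ (d - r)) + smult 9 m"
proof -
  let ?t = "\<lambda>s. smult (coeff p s * 9 ^ (s div 3)) (poly_a ^ (d - s) * poly_x ^ (s div 3))"
  have "step_quot 1 r d p = ?t r + (\<Sum>s\<in>{s. s \<le> d \<and> s mod 3 = r} - {r}. ?t s)"
    unfolding step_quot_def div_by_1 by (rule sum.remove) (use assms in auto)
  also have "(\<Sum>s\<in>{s. s \<le> d \<and> s mod 3 = r} - {r}. ?t s) =
      (\<Sum>s\<in>{s. s \<le> d \<and> s mod 3 = r} - {r}. smult 9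
        (smult (coeff p s * 9 ^ (s div 3 - 1)) (poly_a ^ (d - s) * poly_x ^ (s div 3))))"
  proof (rule sum.cong[OF refl])
    fix s assume s: "s \<in> {s. s \<le> d \<and> s mod 3 = r} - {r}"
    hence "3 * (s div 3) + r = s" "s \<noteq> r" by auto
    hence "s div 3 \<noteq> 0" by auto
    then obtain k where "s div 3 = Suc k" by (metis not0_implies_Suc)
    thus "?t s = smult 9 (smult (coeff p s * 9 ^ (s div 3 - 1)) (poly_a ^ (d - s) * poly_x ^ (s div 3)))"
      by (simp add: mult_ac)
  qed
  finally show ?thesis using assms unfolding smult_sum_right[symmetric] by auto
qed

lemma later_sections:
  shows "3 ^ 8 dvd sect 1 (sect 2 (sect 2 frobenius_gf)) $ n"
    and "3 ^ 9 dvd sect 2 (sect 2 (sect 2 frobenius_gf)) $ n"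
    and "3 ^ 10 dvd sect 1 (sect 1 (sect 2 (sect 2 frobenius_gf))) $ n"
    and "\<exists>p. sect 2 (sect 1 (sect 2 (sect 2 frobenius_gf))) = of_int (3 ^ 12) * form 99 92 272 p \<and> degree p \<le> 272"
proof -
  define p where "p = poly_q ^ 11 * step_quot 9 2 9 (poly_q ^ 4 * poly_a)"
  have deg: "degree p \<le> 29"
    unfolding p_def using degree_step[of 2 11 9 9] by simp
  have F2: "sect 2 (sect 2 frobenius_gf) = of_int (3 ^ 7) * form 18 11 29 p"
    unfolding p_def by (rule second_sections)
  have "3 ^ 1 * 1 dvd sect 1 (form 18 11 29 p) $ n" by (intro form_sect_dvd deg) auto
  thus "3 ^ 8 dvd sect 1 (sect 2 (sect 2 frobenius_gf)) $ n"
    unfolding F2 by (rule sect_of_int_mult_dvd) simp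
  have "3 ^ 2 * 1 dvd sect 2 (form 18 11 29 p) $ n" by (intro form_sect_dvd deg) auto
  thus "3 ^ 9 dvd sect 2 (sect 2 (sect 2 frobenius_gf)) $ n"
    unfolding F2 by (rule sect_of_int_mult_dvd) simp
  define p' where "p' = poly_q ^ 31 * step_quot 1 1 29 p"
  have deg': "degree p' \<le> 90"
    unfolding p'_def using degree_step[of 1 31 1 29] by simp
  \<comment> \<open>The exponent 31 solves \<open>1 + 10 * 11 = 18 + 3 * k\<close>; the exponent 92
    further down solves \<open>2 + 10 * 31 = 36 + 3 * k\<close>.\<close>
  have "sect 1 (form 18 11 29 p) = of_int (3 ^ 1 * 1) *
      form (3 * 11 + 3 * 1) 31 (2 * 31 + (29 - 1)) (poly_q ^ 31 * step_quot 1 1 29 p)"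
    by (intro form_step deg) auto
  hence F3: "sect 1 (sect 2 (sect 2 frobenius_gf)) = of_int (3 ^ 8) * form 36 31 90 p'"
    unfolding F2 sect_of_int_mult p'_def by simp
  obtain m where m: "step_quot 1 1 29 p = smult (coeff p 1) (poly_a ^ 28) + smult 9 m"
    using step_quot_1_mod_9[of 1 29 p] by auto
  have p': "p' = smult (coeff p 1) (poly_q ^ 31 * poly_a ^ 28) + smult 9 (poly_q ^ 31 * m)"
    unfolding p'_def m by (simp add: distrib_left)
  \<comment> \<open>Modulo 9, \<open>p'\<close> is a multiple of one explicit product, whose
    coefficients of index 1 and 2 are 87 and 3744. This gives the divisibility whatever the value of
    \<open>coeff p 1\<close>.\<close>
  have low: "3 dvd coeff p' 1" "9 dvd coeff p' 2"
  proof -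
    have "coeff (poly_q ^ 31 * poly_a ^ 28) 1 = 3 * 29" "coeff (poly_q ^ 31 * poly_a ^ 28) 2 = 9 * 416"
      using coeff_q_a_low(2,3)[of 31 28] by simp_all
    thus "3 dvd coeff p' 1" "9 dvd coeff p' 2"
      unfolding p' by (auto simp del: One_nat_def intro!: dvd_add)
  qed
  have "3 dvd coeff p' s * 9 ^ (s div 3)" if "s mod 3 = 1" for s
    by (rule dvd_by_residue[OF _ that low(1)]) auto
  hence "3 ^ 1 * 3 dvd sect 1 (form 36 31 90 p') $ n"
    by (intro form_sect_dvd deg') auto
  thus "3 ^ 10 dvd sect 1 (sect 1 (sect 2 (sect 2 frobenius_gf))) $ n"
    unfolding F3 by (rule sect_of_int_mult_dvd) simp
  have "9 dvd coeff p' s * 9 ^ (s div 3)" if "s mod 3 = 2" for s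
    by (rule dvd_by_residue[OF _ that low(2)]) auto
  hence "sect 2 (form 36 31 90 p') = of_int (3 ^ 2 * 9) *
      form (3 * 31 + 3 * 2) 92 (2 * 92 + (90 - 2)) (poly_q ^ 92 * step_quot 9 2 90 p')"
    by (intro form_step deg') auto
  hence "sect 2 (sect 1 (sect 2 (sect 2 frobenius_gf))) =
      of_int (3 ^ 12) * form 99 92 272 (poly_q ^ 92 * step_quot 9 2 90 p')"
    unfolding F3 sect_of_int_mult by simp
  moreover have "degree (poly_q ^ 92 * step_quot 9 2 90 p') \<le> 272"
    using degree_step[of 2 92 9 90] by simp
  ultimately show "\<exists>p. sect 2 (sect 1 (sect 2 (sect 2 frobenius_gf))) = of_int (3 ^ 12) * form 99 92 272 p \<and> degree p \<le> 272"
    by blast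
qed

text \<open>The last two powers are \<open>3 ^ 12\<close> times the factor \<open>3 ^ r\<close>
  produced by extracting the residue \<open>r\<close>.\<close>

lemma last_sections:
  "3 ^ 12 dvd sect 2 (sect 1 (sect 2 (sect 2 frobenius_gf))) $ n"
  "3 ^ 13 dvd sect 1 (sect 2 (sect 1 (sect 2 (sect 2 frobenius_gf)))) $ n"
  "3 ^ 14 dvd sect 2 (sect 2 (sect 1 (sect 2 (sect 2 frobenius_gf)))) $ n"
proof -
  obtain p where F4: "sect 2 (sect 1 (sect 2 (sect 2 frobenius_gf))) = of_int (3 ^ 12) * form 99 92 272 p"
    and deg: "degree p \<le> 272" using later_sections(4) by blast
  show "3 ^ 12 dvd sect 2 (sect 1 (sect 2 (sect 2 frobenius_gf))) $ n"
    unfolding F4 by (simp flip: fps_of_int)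
  have "3 ^ 1 * 1 dvd sect 1 (form 99 92 272 p) $ n" by (intro form_sect_dvd deg) auto
  thus "3 ^ 13 dvd sect 1 (sect 2 (sect 1 (sect 2 (sect 2 frobenius_gf)))) $ n"
    unfolding F4 by (rule sect_of_int_mult_dvd) simp
  have "3 ^ 2 * 1 dvd sect 2 (form 99 92 272 p) $ n" by (intro form_sect_dvd deg) auto
  thus "3 ^ 14 dvd sect 2 (sect 2 (sect 1 (sect 2 (sect 2 frobenius_gf)))) $ n"
    unfolding F4 by (rule sect_of_int_mult_dvd) simp
qed

lemma cphi_cong:
  assumes "int (3 ^ k) dvd frobenius_gf $ n"
  shows "[cphi 3 n = 0] (mod 3 ^ k)"
proof -
  have "int (3 ^ k) dvd int (cphi 3 n)"
    using assms by (simp add: cphi_generating_function frobenius_gf_def)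
  thus ?thesis unfolding cong_0_iff by (simp only: int_dvd_int_iff)
qed

theorem theorem1p1:
  fixes n :: nat
  shows
     "[cphi 3 (3 * n + 1) = 0] (mod 3 ^ 2) \<and>
      [cphi 3 (3 * n + 2) = 0] (mod 3 ^ 3) \<and>
      [cphi 3 (9 * n + 5) = 0] (mod 3 ^ 5) \<and>
      [cphi 3 (9 * n + 8) = 0] (mod 3 ^ 7) \<and>
      [cphi 3 (27 * n + 17) = 0] (mod 3 ^ 8) \<and>
      [cphi 3 (27 * n + 26) = 0] (mod 3 ^ 9) \<and>
      [cphi 3 (81 * n + 44) = 0] (mod 3 ^ 10) \<and>
      [cphi 3 (81 * n + 71) = 0] (mod 3 ^ 12) \<and>
      [cphi 3 (243 * n + 152) = 0] (mod 3 ^ 13) \<and>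
      [cphi 3 (243 * n + 233) = 0] (mod 3 ^ 14)"
proof -
  \<comment> \<open>Nested extractions compose to the stated progressions: extracting residue
    \<open>r\<close> from the progression \<open>m * n + s\<close> gives
    \<open>3 * m * n + m * r + s\<close>.\<close>
  have "3 ^ 3 dvd sect 2 frobenius_gf $ n"
    unfolding frobenius_gf_sect_2 by (simp flip: fps_of_int)
  moreover have "3 ^ 7 dvd sect 2 (sect 2 frobenius_gf) $ n"
    unfolding second_sections(2) by (simp flip: fps_of_int)
  ultimately show ?thesis
    using frobenius_gf_sect_1[of n] second_sections(1)[of n] later_sections(1-3)[of n] last_sections[of n]
    by (intro conjI cphi_cong) (simp_all add: algebra_simps)
qed

end
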